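(* Let $\mu$ be an infinitely divisible distribution on $\mathbb{R}$ with characteristic triplet $(\sigma^2,\gamma,\nu)$ and symmetrized jump measure $\nu_s$. Assume that for some $\delta\in(0,1)$ the measure $x\,\nu_s(\mathrm{d}x)$ admits on $(0,\delta]$ a Lebesgue density $k_s$ with $k_s\in BV([\varepsilon,\delta])$ for all $\varepsilon\in(0,\delta)$, that $\|(Dk_s)^+\|_{TV([0,\delta])}:=\lim_{\varepsilon\downarrow0}\|(Dk_s)^+\|_{TV([\varepsilon,\delta])}<\infty$, and that $k_s\in BV([0,\delta])$. Suppose further that the measure $x\,\nu(\mathrm{d}x)$ is absolutely continuous (with respect to Lebesgue measure) on $\mathbb{R}$, and let $\alpha:=k_s(0+)>1$. Then $\mu$ admits a Lebesgue density $f\in C^n(\mathbb{R})$ for any integer $n$ with $0\le n<\alpha-1$.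
   Context: An infinitely divisible distribution $\mu$ on $\mathbb{R}$ with characteristic triplet $(\sigma^2,\gamma,\nu)$ ($\sigma^2\ge0$, $\gamma\in\mathbb{R}$, $\nu$ a Lévy measure) has characteristic function $$\varphi(u)=\int e^{iux}\mu(\mathrm{d}x)=\exp\Big(-\tfrac{\sigma^2}{2}u^2+i\gamma u+\int\big(e^{iux}-1-iux\mathbf{1}_{[-1,1]}(x)\big)\nu(\mathrm{d}x)\Big),\quad u\in\mathbb{R}.$$ The symmetrized jump measure on $\mathbb{R}_+$ is $\nu_s(A):=\nu(A)+\nu(-A)$ for Borel sets $A\subseteq\mathbb{R}_+$ (note $\nu(\{0\})=0$). For a locally integrable function $f$ on an interval, if the distributional derivative of $f$ is a finite signed measure, this measure is denoted $Df$. $BV([a,b])$ is the space of such functions on $[a,b]$ (with $Df$ a finite signed measure on the interior of the interval). $f(x+)$ denotes the right limit at $x$ (of a version of $f$ having one-sided limits). $(Df)^+$ denotes the positive part of $Df$ in its Jordan decomposition and $\|\cdot\|_{TV}$ the total variation norm. $C^n(\mathbb{R})$ denotes the $n$ times continuously differentiable functions ($C^0$ the continuous ones). *)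

theory Defs
  imports "HOL-Probability.Probability"
begin

section \<open>Infinitely divisible distributions\<close>

primrec conv_power :: "nat \<Rightarrow> real measure \<Rightarrow> real measure" where
  "conv_power 0 \<rho> = return borel 0"
| "conv_power (Suc n) \<rho> = convolution (conv_power n \<rho>) \<rho>"

definition infinitely_divisible :: "real measure \<Rightarrow> bool" where
  "infinitely_divisible \<mu> \<longleftrightarrow>
     real_distribution \<mu> \<and> (\<forall>n\<ge>1. \<exists>\<rho>. real_distribution \<rho> \<and> \<mu> = conv_power n \<rho>)"

definition levy_measure :: "real measure \<Rightarrow> bool" where
  "levy_measure \<nu> \<longleftrightarrow>
     sets \<nu> = sets borel \<and> emeasure \<nu> {0} = 0 \<and> (\<integral>\<^sup>+x. ennreal (min 1 (x\<^sup>2)) \<partial>\<nu>) < \<infinity>"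

definition characteristic_triplet ::
    "real measure \<Rightarrow> real \<Rightarrow> real \<Rightarrow> real measure \<Rightarrow> bool" where
  "characteristic_triplet \<mu> \<sigma>2 \<gamma> \<nu> \<longleftrightarrow>
     \<sigma>2 \<ge> 0 \<and> levy_measure \<nu> \<and>
     (\<forall>u. char \<mu> u =
        exp (- complex_of_real (\<sigma>2 / 2 * u\<^sup>2) + \<i> * complex_of_real (\<gamma> * u)
             + (CLINT x|\<nu>. iexp (u * x) - 1 - \<i> * complex_of_real (u * x * indicator {-1..1} x))))"

definition symmetrized_jump_measure :: "real measure \<Rightarrow> real measure" where
  "symmetrized_jump_measure \<nu> =
     measure_of {0..} {A \<in> sets borel. A \<subseteq> {0..}} (\<lambda>A. emeasure \<nu> A + emeasure \<nu> (uminus ` A))"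

lemma borel_subsets_eq:
  fixes I :: "real set"
  assumes "I \<in> sets borel"
  shows "{A \<in> sets borel. A \<subseteq> I} = sets (restrict_space borel I)"
  using assms by (auto simp: sets_restrict_space image_iff Int_absorb1)

lemma space_symmetrized_jump_measure: "space (symmetrized_jump_measure \<nu>) = {0..}"
  unfolding symmetrized_jump_measure_def by (rule space_measure_of) auto

lemma sets_symmetrized_jump_measure:
  "sets (symmetrized_jump_measure \<nu>) = {A \<in> sets borel. A \<subseteq> {0..}}"
proof -
  have eq: "{A \<in> sets borel. A \<subseteq> {0..}} = sets (restrict_space borel {0::real..})"
    by (rule borel_subsets_eq) simp
  have "sigma_algebra (space (restrict_space borel {0::real..})) (sets (restrict_space borel {0..}))"
    by (rule sets.sigma_algebra_axioms)
  then have "sigma_algebra {0::real..} {A \<in> sets borel. A \<subseteq> {0..}}"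
    by (simp add: eq space_restrict_space)
  then show ?thesis
    unfolding symmetrized_jump_measure_def by (rule sigma_algebra.sets_measure_of_eq)
qed

lemma emeasure_symmetrized_jump_measure:
  assumes s: "sets \<nu> = sets borel" and A: "A \<in> sets borel" "A \<subseteq> {0..}"
  shows "emeasure (symmetrized_jump_measure \<nu>) A = emeasure \<nu> A + emeasure \<nu> (uminus ` A)"
proof (rule emeasure_measure_of[OF symmetrized_jump_measure_def])
  have im: "uminus ` B = uminus -` B \<inter> space borel" for B :: "real set"
    by (auto simp: image_iff) (metis minus_minus)
  have meas: "uminus ` B \<in> sets \<nu>" if "B \<in> sets borel" for B :: "real set"
    unfolding s im using that by (intro measurable_sets[of uminus borel borel]) auto
  show "{A \<in> sets borel. A \<subseteq> {0..}} \<subseteq> Pow {0::real..}" by auto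
  show "A \<in> sets (symmetrized_jump_measure \<nu>)"
    using A by (simp add: sets_symmetrized_jump_measure)
  show "positive (sets (symmetrized_jump_measure \<nu>)) (\<lambda>A. emeasure \<nu> A + emeasure \<nu> (uminus ` A))"
    by (simp add: positive_def)
  show "countably_additive (sets (symmetrized_jump_measure \<nu>))
          (\<lambda>A. emeasure \<nu> A + emeasure \<nu> (uminus ` A))"
  proof (rule countably_additiveI)
    fix F :: "nat \<Rightarrow> real set"
    assume F: "range F \<subseteq> sets (symmetrized_jump_measure \<nu>)" and d: "disjoint_family F"
    have F': "F i \<in> sets borel" for i
      using F by (auto simp: sets_symmetrized_jump_measure)
    have d': "disjoint_family (\<lambda>i. uminus ` F i)"
      using d unfolding disjoint_family_on_def by fastforce
    have "(\<Sum>i. emeasure \<nu> (F i) + emeasure \<nu> (uminus ` F i))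
        = (\<Sum>i. emeasure \<nu> (F i)) + (\<Sum>i. emeasure \<nu> (uminus ` F i))"
      by (rule suminf_add[symmetric]) auto
    also have "(\<Sum>i. emeasure \<nu> (F i)) = emeasure \<nu> (\<Union>i. F i)"
      by (rule suminf_emeasure) (use F' d s in auto)
    also have "(\<Sum>i. emeasure \<nu> (uminus ` F i)) = emeasure \<nu> (\<Union>i. uminus ` F i)"
      by (rule suminf_emeasure) (use F' meas d' in auto)
    finally show "(\<Sum>i. emeasure \<nu> (F i) + emeasure \<nu> (uminus ` F i))
        = emeasure \<nu> (\<Union> (range F)) + emeasure \<nu> (uminus ` \<Union> (range F))"
      by (simp add: image_UN)
  qed
qed

text \<open>
  \<open>k\<close> is a Lebesgue density of \<open>M\<close> on \<open>S\<close>. Nonnegativity has to be required, because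
  \<^const>\<open>ennreal\<close> truncates negative values to 0.
\<close>

definition admits_density_on :: "real measure \<Rightarrow> real set \<Rightarrow> (real \<Rightarrow> real) \<Rightarrow> bool" where
  "admits_density_on M S k \<longleftrightarrow>
     set_borel_measurable borel S k \<and>
     (AE x in lborel. x \<in> S \<longrightarrow> 0 \<le> k x) \<and>
     (\<forall>A\<in>sets borel. A \<subseteq> S \<longrightarrow> emeasure M A = (\<integral>\<^sup>+x\<in>A. ennreal (k x) \<partial>lborel))"

section \<open>Distributional derivatives and functions of bounded variation\<close>

definition C_n :: "nat \<Rightarrow> (real \<Rightarrow> real) \<Rightarrow> bool" where
  "C_n n f \<longleftrightarrow>
     (\<forall>j<n. \<forall>x. (deriv ^^ j) f field_differentiable at x) \<and>
     (\<forall>j\<le>n. continuous_on UNIV ((deriv ^^ j) f))"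

definition test_function :: "real set \<Rightarrow> (real \<Rightarrow> real) \<Rightarrow> bool" where
  "test_function I \<phi> \<longleftrightarrow>
     (\<forall>n. C_n n \<phi>) \<and> (\<exists>K. compact K \<and> K \<subseteq> I \<and> (\<forall>x. x \<notin> K \<longrightarrow> \<phi> x = 0))"

definition finite_signed_measure :: "real set \<Rightarrow> (real set \<Rightarrow> real) \<Rightarrow> bool" where
  "finite_signed_measure I m \<longleftrightarrow>
     m {} = 0 \<and>
     (\<forall>A :: nat \<Rightarrow> real set. range A \<subseteq> sets (restrict_space borel I) \<and> disjoint_family A \<longrightarrow>
        (\<lambda>i. m (A i)) sums m (\<Union>i. A i))"

definition jordan_decomposition ::
    "real set \<Rightarrow> (real set \<Rightarrow> real) \<Rightarrow> real measure \<Rightarrow> real measure \<Rightarrow> bool" where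
  "jordan_decomposition I m P N \<longleftrightarrow>
     finite_measure P \<and> finite_measure N \<and>
     sets P = sets (restrict_space borel I) \<and> sets N = sets (restrict_space borel I) \<and>
     (\<exists>H\<in>sets (restrict_space borel I). emeasure P (I - H) = 0 \<and> emeasure N H = 0) \<and>
     (\<forall>A\<in>sets (restrict_space borel I). m A = measure P A - measure N A)"

text \<open>The Jordan decomposition of a finite signed measure exists and is unique.\<close>

definition positive_part :: "real set \<Rightarrow> (real set \<Rightarrow> real) \<Rightarrow> real measure" where
  "positive_part I m = (SOME P. \<exists>N. jordan_decomposition I m P N)"

text \<open>
  \<open>m\<close> is the distributional derivative of \<open>f\<close> on the open interval \<open>I\<close>; the integral of a test
  function against \<open>m\<close> is taken via the Jordan decomposition of \<open>m\<close>.
\<close>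

definition is_distributional_derivative ::
    "real set \<Rightarrow> (real \<Rightarrow> real) \<Rightarrow> (real set \<Rightarrow> real) \<Rightarrow> bool" where
  "is_distributional_derivative I f m \<longleftrightarrow>
     finite_signed_measure I m \<and>
     (\<exists>P N. jordan_decomposition I m P N \<and>
        (\<forall>\<phi>. test_function I \<phi> \<longrightarrow>
           (LBINT x:I. f x * deriv \<phi> x) = - ((LINT x|P. \<phi> x) - (LINT x|N. \<phi> x))))"

definition BV :: "real \<Rightarrow> real \<Rightarrow> (real \<Rightarrow> real) \<Rightarrow> bool" where
  "BV a b f \<longleftrightarrow>
     set_integrable lborel {a..b} f \<and> (\<exists>m. is_distributional_derivative {a<..<b} f m)"

text \<open>On Borel subsets of \<open>(a, b)\<close>, the derivative measure of a BV function is unique.\<close>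

definition deriv_measure :: "real \<Rightarrow> real \<Rightarrow> (real \<Rightarrow> real) \<Rightarrow> real set \<Rightarrow> real" where
  "deriv_measure a b f = (SOME m. is_distributional_derivative {a<..<b} f m)"

text \<open>The total variation norm of the positive measure \<open>(Df)\<^sup>+\<close> is its total mass.\<close>

definition positive_TV :: "real \<Rightarrow> real \<Rightarrow> (real \<Rightarrow> real) \<Rightarrow> ennreal" where
  "positive_TV a b f = emeasure (positive_part {a<..<b} (deriv_measure a b f)) {a<..<b}"

definition positive_TV_from_0 :: "real \<Rightarrow> (real \<Rightarrow> real) \<Rightarrow> ennreal" where
  "positive_TV_from_0 \<delta> f = Lim (at_right 0) (\<lambda>\<epsilon>. positive_TV \<epsilon> \<delta> f)"

text \<open>
  The right limit at \<open>x \<in> [a, b)\<close> of a version of \<open>f\<close> with one-sided limits. Two such versions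
  agree almost everywhere on \<open>(a, b)\<close> and hence have the same right limit.
\<close>

definition right_limit :: "real \<Rightarrow> real \<Rightarrow> (real \<Rightarrow> real) \<Rightarrow> real \<Rightarrow> real" where
  "right_limit a b f x =
     (THE L. \<exists>g. (AE y in lborel. y \<in> {a<..<b} \<longrightarrow> g y = f y) \<and>
        (\<forall>y\<in>{a<..<b}. (\<exists>l. (g \<longlongrightarrow> l) (at_left y)) \<and> (\<exists>r. (g \<longlongrightarrow> r) (at_right y))) \<and>
        (g \<longlongrightarrow> L) (at_right x))"

end

theory Submission
  imports Defs "HOL-Real_Asymp.Real_Asymp"
begin

text \<open>
  The right limit \<open>\<alpha>\<close> governs the decay of the characteristic function \<open>\<phi>\<close> of \<open>\<mu>\<close>. For
  \<open>0 \<le> \<beta> < \<alpha>\<close> the density \<open>k\<^sub>s\<close> is at least \<open>\<beta>\<close> almost everywhere on some interval \<open>(0, \<eta>]\<close>, so by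
  the Levy-Khintchine formula \<open>- ln \<bar>\<phi>(u)\<bar>\<close> is at least the \<open>\<nu>\<close>-integral of \<open>1 - cos (u x)\<close>, which
  is at least \<open>\<beta>\<close> times the integral of \<open>(1 - cos (u x)) / x\<close> over \<open>(0, \<eta>]\<close>, which is at least
  \<open>\<beta> (ln (\<bar>u\<bar> \<eta>) - 1)\<close>. So \<open>\<phi>(u)\<close> is bounded by a multiple of \<open>\<bar>u\<bar> powr (- \<beta>)\<close> for large \<open>\<bar>u\<bar>\<close>
  (\<open>char_polynomial_decay\<close>). Given \<open>n < \<alpha> - 1\<close>, a \<open>\<beta>\<close> strictly between \<open>n + 1\<close> and \<open>\<alpha>\<close> makes
  \<open>\<bar>u\<bar>\<^sup>n \<phi>(u)\<close> integrable. Fourier inversion then yields the density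
  (\<open>density_fourier_inversion\<close>), and differentiating \<open>n\<close> times under the inversion integral
  shows that it is \<open>n\<close> times continuously differentiable (\<open>C_n_Re_fourier_moment\<close>). The same
  density serves every \<open>n\<close>.

  The strict inequality \<open>n < \<alpha> - 1\<close> leaves room to lose an arbitrarily small part of the exponent,
  so that the convergence of \<open>k\<^sub>s\<close> to \<open>\<alpha>\<close> at 0 is enough, at whatever rate.

  The remaining work is to show that \<open>\<alpha>\<close> really is such a limit: \<open>right_limit\<close> is a definite
  description, which carries information only if a version of \<open>k\<^sub>s\<close> with one-sided limits exists and
  its right limit at 0 is unique. A function whose distributional derivative is \<open>P - N\<close>, with finite
  measures \<open>P\<close> and \<open>N\<close>, has the same derivative as the difference of the distribution functions of
  \<open>P\<close> and \<open>N\<close>; by the lemma of du Bois-Reymond the two differ by a constant almost everywhere, and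
  distribution functions have one-sided limits (\<open>right_limit_BV\<close>). The du Bois-Reymond lemma in turn
  needs enough test functions, namely smooth bumps that converge boundedly to the indicator of any
  given interval.
\<close>

section \<open>Smooth bump functions\<close>

text \<open>
  No formula for higher derivatives is needed: a set of differentiable functions that is closed under
  \<open>deriv\<close> contains only smooth functions. Products, affine substitutions and \<open>exp (- 1 / x)\<close> are treated
  below by exhibiting such a set.
\<close>

lemma smooth_coinduct:
  assumes "f \<in> S"
    and "\<And>g. g \<in> S \<Longrightarrow> (\<forall>x. g field_differentiable at x) \<and> deriv g \<in> S"
  shows "C_n n f"
proof -
  have *: "(deriv ^^ j) f \<in> S" for j
    by (induction j) (use assms in auto)
  show ?thesis
    unfolding C_n_def
    using assms(2)[OF *]
    by (auto intro!: continuous_at_imp_continuous_on field_differentiable_imp_continuous_at)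
qed

definition smooth :: "(real \<Rightarrow> real) \<Rightarrow> bool" where
  "smooth f \<longleftrightarrow> (\<forall>n. C_n n f)"

lemma smooth_field_differentiable:
  assumes "smooth f"
  shows "f field_differentiable at x"
proof -
  have "C_n 1 f" using assms by (simp add: smooth_def)
  then show ?thesis unfolding C_n_def by (metis funpow_0 less_one)
qed

lemma smooth_DERIV: "smooth f \<Longrightarrow> (f has_real_derivative deriv f x) (at x)"
  using smooth_field_differentiable field_differentiable_derivI by blast

lemma smooth_continuous_on: "smooth f \<Longrightarrow> continuous_on A f"
  by (meson continuous_at_imp_continuous_on field_differentiable_imp_continuous_at
      smooth_field_differentiable)

lemma smooth_measurable: "smooth f \<Longrightarrow> f \<in> borel_measurable borel"
  by (intro borel_measurable_continuous_onI smooth_continuous_on)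

lemma smooth_iff_deriv:
  "smooth f \<longleftrightarrow> (\<forall>x. f field_differentiable at x) \<and> smooth (deriv f)"
proof safe
  assume f: "smooth f"
  show "f field_differentiable at x" for x
    by (rule smooth_field_differentiable[OF f])
  show "smooth (deriv f)"
    unfolding smooth_def
  proof
    fix n
    have *: "C_n (Suc n) f" using f by (simp add: smooth_def)
    have eq: "(deriv ^^ j) (deriv f) = (deriv ^^ (Suc j)) f" for j
      by (simp add: funpow_swap1)
    show "C_n n (deriv f)"
      using * unfolding C_n_def eq by (meson Suc_less_eq Suc_le_mono)
  qed
next
  assume d: "\<forall>x. f field_differentiable at x" and s: "smooth (deriv f)"
  have "(deriv ^^ j) (deriv f) = (deriv ^^ (Suc j)) f" for j
    by (simp add: funpow_swap1)
  then have "(\<forall>x. (deriv ^^ j) f field_differentiable at x)" for j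
    using d s by (cases j) (auto simp: smooth_def C_n_def, metis lessI)
  then show "smooth f"
    by (auto simp: smooth_def C_n_def
        intro!: continuous_at_imp_continuous_on field_differentiable_imp_continuous_at)
qed

lemma smooth_antiderivative:
  assumes "\<And>x. (F has_real_derivative f x) (at x)" "smooth f"
  shows "smooth F" "deriv F = f"
proof -
  show "deriv F = f" using assms(1) by (auto intro: DERIV_imp_deriv)
  then show "smooth F"
    using assms by (subst smooth_iff_deriv) (auto simp: field_differentiable_def)
qed

lemma smooth_affine:
  assumes "smooth f"
  shows "smooth (\<lambda>x. f (a * x + b))"
proof -
  define S where "S = {\<lambda>x. c * g (a * x + b) |c g. smooth g}"
  have "(\<lambda>x. f (a * x + b)) \<in> S" unfolding S_def
    using assms by (auto intro!: exI[of _ 1] exI[of _ f])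
  moreover have "(\<forall>x. h field_differentiable at x) \<and> deriv h \<in> S" if hS: "h \<in> S" for h
  proof -
    obtain c g where g: "smooth g" and h: "h = (\<lambda>x. c * g (a * x + b))"
      using hS unfolding S_def by blast
    have D: "(h has_real_derivative (c * a) * deriv g (a * x + b)) (at x)" for x
      unfolding h
      by (auto intro!: derivative_eq_intros DERIV_chain2[OF smooth_DERIV[OF g]])
    then have "deriv h = (\<lambda>x. (c * a) * deriv g (a * x + b))"
      by (auto intro: DERIV_imp_deriv)
    with D g show ?thesis
      unfolding S_def using smooth_iff_deriv[of g]
      by (auto simp: field_differentiable_def)
  qed
  ultimately show ?thesis
    unfolding smooth_def using smooth_coinduct by blast
qed

text \<open>
  Products of two smooth functions are not closed under \<open>deriv\<close>, because of the Leibniz rule;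
  finite sums of such products are.
\<close>
inductive_set product_sums :: "(real \<Rightarrow> real) set" where
  product: "smooth f \<Longrightarrow> smooth g \<Longrightarrow> (\<lambda>x. f x * g x) \<in> product_sums"
| sum: "f \<in> product_sums \<Longrightarrow> g \<in> product_sums \<Longrightarrow> (\<lambda>x. f x + g x) \<in> product_sums"

lemma deriv_product_sums:
  "f \<in> product_sums \<Longrightarrow> (\<forall>x. f field_differentiable at x) \<and> deriv f \<in> product_sums"
proof (induction rule: product_sums.induct)
  case (product f g)
  have D: "((\<lambda>x. f x * g x) has_real_derivative deriv f x * g x + f x * deriv g x) (at x)" for x
    using product by (auto intro!: derivative_eq_intros smooth_DERIV)
  have "(\<lambda>x. deriv f x * g x + f x * deriv g x) \<in> product_sums"
    using product by (intro product_sums.intros) (auto simp: smooth_iff_deriv[of f] smooth_iff_deriv[of g])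
  then show ?case
    using D by (auto simp: field_differentiable_def DERIV_imp_deriv[OF D])
next
  case (sum f g)
  then have D: "((\<lambda>x. f x + g x) has_real_derivative deriv f x + deriv g x) (at x)" for x
    by (auto intro!: derivative_eq_intros field_differentiable_derivI)
  have "(\<lambda>x. deriv f x + deriv g x) \<in> product_sums"
    using sum by (intro product_sums.intros) auto
  then show ?case
    using D by (auto simp: field_differentiable_def DERIV_imp_deriv[OF D])
qed

lemma smooth_product_sums: "f \<in> product_sums \<Longrightarrow> smooth f"
  unfolding smooth_def using smooth_coinduct deriv_product_sums by blast

lemma smooth_mult: "smooth f \<Longrightarrow> smooth g \<Longrightarrow> smooth (\<lambda>x. f x * g x)"
  using smooth_product_sums product_sums.product by blast

lemma smooth_const: "smooth (\<lambda>x. c)"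
  unfolding smooth_def
  by (auto intro!: smooth_coinduct[of _ "range (\<lambda>c x. c)"])

lemma smooth_linear_combination:
  "smooth f \<Longrightarrow> smooth g \<Longrightarrow> smooth (\<lambda>x. c * f x + d * g x)"
  by (rule smooth_product_sums) (intro product_sums.sum product_sums.product smooth_const)

text \<open>
  The function \<open>exp (- 1 / x)\<close> with a polynomial prefactor in \<open>1 / x\<close>, extended by 0 to the left of
  the origin. The prefactor makes the family closed under differentiation.
\<close>
definition flat :: "real poly \<Rightarrow> real \<Rightarrow> real" where
  "flat p x = (if x \<le> 0 then 0 else poly p (1 / x) * exp (- (1 / x)))"

lemma poly_over_exp_tendsto_0:
  fixes p :: "real poly"
  shows "((\<lambda>t. poly p t * exp (- t)) \<longlongrightarrow> 0) at_top"
proof -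
  have "((\<lambda>t. \<Sum>i\<le>degree p. coeff p i * (t ^ i / exp t)) \<longlongrightarrow> (\<Sum>i\<le>degree p. coeff p i * 0)) at_top"
    by (intro tendsto_intros tendsto_power_div_exp_0)
  then show ?thesis
    by (simp add: poly_altdef exp_minus sum_distrib_right sum_divide_distrib divide_simps)
qed

lemma DERIV_flat:
  "(flat p has_real_derivative flat ([:0, 0, 1:] * (p - pderiv p)) x) (at x)"
proof -
  consider "x < 0" | "x > 0" | "x = 0" by linarith
  then show ?thesis
  proof cases
    case 1
    have "((\<lambda>_. 0) has_real_derivative 0) (at x)" by simp
    moreover have "\<forall>\<^sub>F y in nhds x. flat p y = 0"
      using 1 eventually_nhds_in_open[of "{..<0}" x]
      by (auto elim!: eventually_mono simp: flat_def)
    ultimately show ?thesis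
      using 1 DERIV_cong_ev[OF refl, of "flat p" "\<lambda>_. 0" x, OF _ refl] by (simp add: flat_def)
  next
    case 2
    have "((\<lambda>x. poly p (1 / x) * exp (- (1 / x))) has_real_derivative
        flat ([:0, 0, 1:] * (p - pderiv p)) x) (at x)"
      using 2 unfolding flat_def
      by (auto intro!: derivative_eq_intros DERIV_chain2[OF poly_DERIV]
          simp: field_simps power2_eq_square)
    moreover have "\<forall>\<^sub>F y in nhds x. flat p y = poly p (1 / y) * exp (- (1 / y))"
      using 2 eventually_nhds_in_open[of "{0<..}" x]
      by (auto elim!: eventually_mono simp: flat_def)
    ultimately show ?thesis
      using DERIV_cong_ev[OF refl, of "flat p" "\<lambda>x. poly p (1 / x) * exp (- (1 / x))" x, OF _ refl]
      by simp
  next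
    case 3
    \<comment> \<open>At 0 the difference quotient is again flat: dividing by \<open>h\<close> multiplies the prefactor by \<open>1 / h\<close>.\<close>
    have "((\<lambda>h. poly (pCons 0 p) (inverse h) * exp (- (inverse h))) \<longlongrightarrow> 0) (at_right 0)"
      by (rule filterlim_compose[OF poly_over_exp_tendsto_0 filterlim_inverse_at_top_right])
    then have r: "((\<lambda>h. flat p h / h) \<longlongrightarrow> 0) (at_right 0)"
      by (rule Lim_transform_eventually)
        (auto simp: eventually_at_right_less flat_def field_simps intro!: eventually_at_rightI[of 0 1])
    have l: "((\<lambda>h. flat p h / h) \<longlongrightarrow> 0) (at_left 0)"
      by (rule tendsto_eventually)
        (auto simp: flat_def intro!: eventually_at_leftI[of "-1" 0])
    have "((\<lambda>h. flat p h / h) \<longlongrightarrow> 0) (at 0)"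
      using l r by (rule filterlim_split_at)
    then show ?thesis
      using 3 by (simp add: DERIV_def flat_def)
  qed
qed

lemma smooth_flat: "smooth (flat p)"
proof -
  have "deriv (flat p) = flat ([:0, 0, 1:] * (p - pderiv p))" for p
    using DERIV_flat by (auto intro: DERIV_imp_deriv)
  then show ?thesis
    unfolding smooth_def
    using DERIV_flat by (intro allI smooth_coinduct[of _ "range flat"]) (auto simp: field_differentiable_def)
qed

text \<open>
  The factor \<open>n\<close> steepens the flanks, so that the bumps tend to 1 inside \<open>(c, d)\<close>. The shift by 1
  keeps the support in \<open>[c + 1/n, d - 1/n]\<close>, a compact subset of \<open>(c, d)\<close>, as a test function on
  \<open>(c, d)\<close> needs.
\<close>
definition bump :: "nat \<Rightarrow> real \<Rightarrow> real \<Rightarrow> real \<Rightarrow> real" where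
  "bump n c d x = flat 1 (real n * (x - c) - 1) * flat 1 (real n * (d - x) - 1)"

lemma smooth_bump: "smooth (bump n c d)"
proof -
  have 1: "smooth (\<lambda>x. flat 1 (real n * x + (- real n * c - 1)))"
    by (intro smooth_affine smooth_flat)
  have 2: "smooth (\<lambda>x. flat 1 ((- real n) * x + (real n * d - 1)))"
    by (intro smooth_affine smooth_flat)
  have "bump n c d = (\<lambda>x. flat 1 (real n * x + (- real n * c - 1)) * flat 1 ((- real n) * x + (real n * d - 1)))"
    by (auto simp: bump_def algebra_simps)
  with smooth_mult[OF 1 2] show ?thesis by metis
qed

lemma flat_1_range: "0 \<le> flat 1 x" "flat 1 x \<le> 1"
  by (auto simp: flat_def)

lemma bump_range: "0 \<le> bump n c d x" "bump n c d x \<le> 1"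
  by (auto simp: bump_def flat_1_range intro!: mult_le_one)

lemma bump_eq_0:
  assumes "x \<notin> {c + 1 / real n .. d - 1 / real n}"
  shows "bump n c d x = 0"
proof (cases "n = 0")
  case False
  then have "real n * (x - c) - 1 \<le> 0 \<or> real n * (d - x) - 1 \<le> 0"
    using assms by (auto simp: field_simps)
  then show ?thesis by (auto simp: bump_def flat_def)
qed (simp add: bump_def flat_def)

lemma flat_1_tendsto_1:
  assumes "0 < (y::real)"
  shows "(\<lambda>n. flat 1 (real n * y - 1)) \<longlonglongrightarrow> 1"
proof -
  have inf: "filterlim (\<lambda>n. - 1 + real n * y) at_top sequentially"
    using assms
    by real_asymp
  have "(\<lambda>n. exp (- inverse (- 1 + real n * y))) \<longlonglongrightarrow> 1"
    using assms by real_asymp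
  moreover have "\<forall>\<^sub>F n in sequentially. exp (- inverse (- 1 + real n * y)) = flat 1 (real n * y - 1)"
    using filterlim_at_top_dense[THEN iffD1, OF inf, rule_format, of 0]
    by eventually_elim (auto simp: flat_def inverse_eq_divide)
  ultimately show ?thesis
    by (simp add: Lim_transform_eventually)
qed

lemma bump_tendsto_indicator: "(\<lambda>n. bump n c d x) \<longlonglongrightarrow> indicator {c<..<d} x"
proof (cases "x \<in> {c<..<d}")
  case True
  then have "(\<lambda>n. bump n c d x) \<longlonglongrightarrow> 1 * 1"
    unfolding bump_def by (intro tendsto_mult flat_1_tendsto_1) auto
  with True show ?thesis by simp
next
  case False
  then have "x \<notin> {c + 1 / real n .. d - 1 / real n}"
    if "n > 0" for n
    using that by (smt (verit) atLeastAtMost_iff greaterThanLessThan_iff of_nat_0_less_iff zero_less_divide_1_iff)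
  then have "bump n c d x = 0" for n
    using bump_eq_0[of x c n d] by (cases "n = 0") (auto simp: bump_def flat_def)
  with False show ?thesis by simp
qed

section \<open>The du Bois-Reymond lemma\<close>

lemma test_function_smooth: "test_function I \<phi> \<Longrightarrow> smooth \<phi>"
  by (simp add: test_function_def smooth_def)

lemma test_functionI:
  assumes "smooth \<phi>" "\<And>x. x \<notin> {c..d} \<Longrightarrow> \<phi> x = 0" "{c..d} \<subseteq> I"
  shows "test_function I \<phi>"
  using assms unfolding test_function_def smooth_def by (metis compact_Icc)

lemma test_function_support:
  assumes "test_function {a<..<b} \<phi>" "a < b"
  obtains c d where "a < c" "c < d" "d < b" "\<And>x. x \<notin> {c..d} \<Longrightarrow> \<phi> x = 0"
proof -
  obtain K where K: "compact K" "K \<subseteq> {a<..<b}" "\<And>x. x \<notin> K \<Longrightarrow> \<phi> x = 0"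
    using assms(1) unfolding test_function_def by blast
  \<comment> \<open>Adding the midpoint to the support makes it nonempty; widening it afterwards makes the interval nondegenerate.\<close>
  define m where "m = (a + b) / 2"
  define K' where "K' = insert m K"
  have K': "compact K'" "K' \<noteq> {}" "K' \<subseteq> {a<..<b}"
    using K assms(2) by (auto simp: K'_def m_def)
  obtain c where c: "c \<in> K'" "\<And>x. x \<in> K' \<Longrightarrow> c \<le> x"
    using compact_attains_inf[OF K'(1,2)] by blast
  obtain d where d: "d \<in> K'" "\<And>x. x \<in> K' \<Longrightarrow> x \<le> d"
    using compact_attains_sup[OF K'(1,2)] by blast
  have cd: "a < c" "d < b" "c \<le> d"
    using c d K'(3) by auto
  show ?thesis
  proof (rule that[of "(a + c) / 2" "(d + b) / 2"])
    show "a < (a + c) / 2" "(a + c) / 2 < (d + b) / 2" "(d + b) / 2 < b"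
      using cd by auto
    fix x assume "x \<notin> {(a + c) / 2..(d + b) / 2}"
    then have "x \<notin> K'" using c d cd by fastforce
    then show "\<phi> x = 0" using K by (auto simp: K'_def)
  qed
qed

lemma test_function_bump:
  assumes "a \<le> c" "d \<le> b" "0 < n"
  shows "test_function {a<..<b} (bump n c d)"
proof (rule test_functionI[OF smooth_bump bump_eq_0])
  have "1 / real n > 0" using assms by simp
  then show "{c + 1 / real n..d - 1 / real n} \<subseteq> {a<..<b}"
    using assms by (meson atLeastAtMost_iff greaterThanLessThan_iff less_add_same_cancel1
        less_diff_eq linorder_not_le order_le_less_trans order_less_le_trans diff_less_eq subsetI)
qed

lemma test_function_linear_combination:
  assumes "test_function {a<..<b} \<phi>" "test_function {a<..<b} \<psi>" "a < b"
  shows "test_function {a<..<b} (\<lambda>x. s * \<phi> x + t * \<psi> x)"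
proof -
  obtain c d where cd: "a < c" "c < d" "d < b" "\<And>x. x \<notin> {c..d} \<Longrightarrow> \<phi> x = 0"
    using test_function_support[OF assms(1,3)] by blast
  obtain e f where ef: "a < e" "e < f" "f < b" "\<And>x. x \<notin> {e..f} \<Longrightarrow> \<psi> x = 0"
    using test_function_support[OF assms(2,3)] by blast
  show ?thesis
  proof (rule test_functionI[where c = "min c e" and d = "max d f"])
    show "smooth (\<lambda>x. s * \<phi> x + t * \<psi> x)"
      using assms by (intro smooth_linear_combination test_function_smooth)
    show "s * \<phi> x + t * \<psi> x = 0" if "x \<notin> {min c e..max d f}" for x
      using that cd(4)[of x] ef(4)[of x] by (auto simp: not_le)
  qed (use cd ef in auto)
qed

lemma test_function_bounded:
  assumes "test_function {a<..<b} \<phi>" "a < b"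
  obtains B where "\<And>x. \<bar>\<phi> x\<bar> \<le> B" "0 \<le> B"
proof -
  obtain c d where cd: "a < c" "c < d" "d < b" "\<And>x. x \<notin> {c..d} \<Longrightarrow> \<phi> x = 0"
    using test_function_support[OF assms] by blast
  have "compact (\<phi> ` {c..d})"
    using assms by (intro compact_continuous_image smooth_continuous_on test_function_smooth) auto
  then obtain B where "\<forall>y\<in>\<phi> ` {c..d}. norm y \<le> B"
    using compact_imp_bounded bounded_iff by blast
  then have "\<bar>\<phi> x\<bar> \<le> max B 0" for x
    using cd(4)[of x] by (cases "x \<in> {c..d}") force+
  then show ?thesis by (rule that) simp
qed

lemma set_integrable_mult_test_function:
  fixes g :: "real \<Rightarrow> real"
  assumes "test_function {a<..<b} \<phi>" "a < b" "set_integrable lborel {a<..<b} g"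
  shows "set_integrable lborel {a<..<b} (\<lambda>x. g x * \<phi> x)"
proof -
  obtain B where B: "\<And>x. \<bar>\<phi> x\<bar> \<le> B" "0 \<le> B"
    using test_function_bounded[OF assms(1,2)] by blast
  have [measurable]: "\<phi> \<in> borel_measurable borel"
    using assms by (intro smooth_measurable test_function_smooth)
  have 1: "integrable lborel (\<lambda>x. B * (indicator {a<..<b} x *\<^sub>R g x))"
    using assms(3) unfolding set_integrable_def by (intro integrable_mult_right)
  have [measurable]: "(\<lambda>x. indicat_real {a<..<b} x * g x) \<in> borel_measurable borel"
    using assms(3) unfolding set_integrable_def by (auto dest!: borel_measurable_integrable)
  have "integrable lborel (\<lambda>x. (indicator {a<..<b} x *\<^sub>R g x) * \<phi> x)"
  proof (rule Bochner_Integration.integrable_bound[OF 1])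
    show "AE x in lborel. norm ((indicator {a<..<b} x *\<^sub>R g x) * \<phi> x)
        \<le> norm (B * (indicator {a<..<b} x *\<^sub>R g x))"
    proof (rule AE_I2)
      fix x
      have "\<bar>indicator {a<..<b} x * g x\<bar> * \<bar>\<phi> x\<bar> \<le> \<bar>indicator {a<..<b} x * g x\<bar> * B"
        using B by (intro mult_left_mono) auto
      then show "norm ((indicator {a<..<b} x *\<^sub>R g x) * \<phi> x)
        \<le> norm (B * (indicator {a<..<b} x *\<^sub>R g x))"
        using B(2) by (simp add: abs_mult mult_ac)
    qed
  qed simp
  then show ?thesis unfolding set_integrable_def by (simp add: mult_ac)
qed

lemma set_integrable_test_function:
  assumes "test_function {a<..<b} \<phi>" "a < b"
  shows "set_integrable lborel {a<..<b} \<phi>"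
proof -
  have "set_integrable lborel {a<..<b} (\<lambda>x. 1 :: real)"
    unfolding set_integrable_def by (simp add: assms(2) less_imp_le)
  from set_integrable_mult_test_function[OF assms this] show ?thesis by simp
qed

lemma continuous_antiderivative:
  fixes f :: "real \<Rightarrow> real"
  assumes "continuous_on UNIV f"
  obtains F where "\<And>x. (F has_real_derivative f x) (at x)"
proof -
  have "\<exists>F. \<forall>x::real. -\<infinity> < ereal x \<longrightarrow> ereal x < \<infinity> \<longrightarrow> (F has_vector_derivative f x) (at x)"
    using assms
    by (intro einterval_antiderivative) (auto simp: continuous_on_eq_continuous_at)
  then show ?thesis
    using that by (auto simp: has_real_derivative_iff_has_vector_derivative)
qed

text \<open>
  The antiderivative that vanishes to the left of the support of \<open>\<psi>\<close> equals the total integral to its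
  right. So a test function is the derivative of a test function as soon as its integral vanishes.
\<close>
lemma test_function_antiderivative:
  assumes \<psi>: "test_function {a<..<b} \<psi>" and ab: "a < b"
    and zero: "(LBINT x:{a<..<b}. \<psi> x) = 0"
  obtains \<phi> where "test_function {a<..<b} \<phi>" "deriv \<phi> = \<psi>"
proof -
  obtain c d where cd: "a < c" "c < d" "d < b" "\<And>x. x \<notin> {c..d} \<Longrightarrow> \<psi> x = 0"
    using test_function_support[OF \<psi> ab] by blast
  note s = test_function_smooth[OF \<psi>]
  obtain F where F: "\<And>x. (F has_real_derivative \<psi> x) (at x)"
    using continuous_antiderivative[OF smooth_continuous_on[OF s]] by blast
  define \<phi> where "\<phi> x = F x - F c" for x
  have D: "(\<phi> has_real_derivative \<psi> x) (at x)" for x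
    unfolding \<phi>_def by (auto intro!: derivative_eq_intros F)
  have cont: "continuous_on A F" for A
    using F by (meson DERIV_isCont continuous_at_imp_continuous_on)
  have "(LBINT x:{c..d}. \<psi> x) = F d - F c"
    unfolding set_lebesgue_integral_def using cd F
    by (subst integral_FTC_Icc_real[of c d F \<psi>, symmetric])
       (auto simp: mult.commute intro!: continuous_on_interior[OF smooth_continuous_on[OF s, of UNIV]])
  also have "(LBINT x:{c..d}. \<psi> x) = (LBINT x:{a<..<b}. \<psi> x)"
    unfolding set_lebesgue_integral_def
    using cd by (intro Bochner_Integration.integral_cong) (auto simp: indicator_def)
  finally have Fdc: "F d = F c" using zero by simp
  have "\<phi> x = 0" if "x \<notin> {c..d}" for x
  proof -
    consider "x < c" | "d < x" using \<open>x \<notin> {c..d}\<close> by fastforce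
    then show ?thesis
    proof cases
      case 1
      have "F c = F x"
        by (rule DERIV_isconst_end[OF 1 cont]) (use F cd(4) in \<open>metis atLeastAtMost_iff not_le\<close>)
      then show ?thesis by (simp add: \<phi>_def)
    next
      case 2
      have "F x = F d"
        by (rule DERIV_isconst_end[OF 2 cont]) (use F cd(4) in \<open>metis atLeastAtMost_iff not_le\<close>)
      then show ?thesis by (simp add: \<phi>_def Fdc)
    qed
  qed
  then have "test_function {a<..<b} \<phi>"
    using cd by (intro test_functionI[of _ c d] smooth_antiderivative[OF D s]) auto
  moreover have "deriv \<phi> = \<psi>" by (rule smooth_antiderivative[OF D s])
  ultimately show ?thesis by (rule that)
qed

text \<open>
  The positive and the negative part of \<open>h\<close> are densities of finite measures that agree on all
  half-lines \<open>{u<..}\<close>, hence on all Borel sets.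
\<close>
lemma AE_zero_of_zero_tail_integrals:
  fixes h :: "real \<Rightarrow> real"
  assumes h: "integrable lborel h"
    and zero: "\<And>u. (\<integral>x. indicator {u<..} x * h x \<partial>lborel) = 0"
  shows "AE x in lborel. h x = 0"
proof -
  have [measurable]: "h \<in> borel_measurable borel" using h by auto
  have e: "emeasure (density lborel (\<lambda>x. ennreal (f x))) {u<..}
      = ennreal (\<integral>x. indicator {u<..} x * max 0 (f x) \<partial>lborel)"
    and i: "integrable lborel (\<lambda>x. indicator {u<..} x * max 0 (f x))"
    if "integrable lborel f" for f :: "real \<Rightarrow> real" and u
  proof -
    have [measurable]: "f \<in> borel_measurable borel" using that by auto
    show i: "integrable lborel (\<lambda>x. indicator {u<..} x * max 0 (f x))"
      by (rule Bochner_Integration.integrable_bound[OF that]) (auto simp: indicator_def)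
    have "emeasure (density lborel (\<lambda>x. ennreal (f x))) {u<..}
        = (\<integral>\<^sup>+x. ennreal (indicator {u<..} x * max 0 (f x)) \<partial>lborel)"
      by (subst emeasure_density)
        (auto intro!: nn_integral_cong simp: indicator_def ennreal_neg max_def)
    also have "\<dots> = ennreal (\<integral>x. indicator {u<..} x * max 0 (f x) \<partial>lborel)"
      by (rule nn_integral_eq_integral[OF i]) auto
    finally show "emeasure (density lborel (\<lambda>x. ennreal (f x))) {u<..}
      = ennreal (\<integral>x. indicator {u<..} x * max 0 (f x) \<partial>lborel)" .
  qed
  have h': "integrable lborel (\<lambda>x. - h x)" using h by simp
  have "density lborel (\<lambda>x. ennreal (h x)) = density lborel (\<lambda>x. ennreal (- h x))"
  proof (rule measure_eqI_lessThan)
    fix u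
    have "(\<integral>x. indicator {u<..} x * max 0 (h x) \<partial>lborel) -
        (\<integral>x. indicator {u<..} x * max 0 (- h x) \<partial>lborel) = (\<integral>x. indicator {u<..} x * h x \<partial>lborel)"
      by (subst Bochner_Integration.integral_diff[OF i[OF h] i[OF h'], symmetric])
        (auto intro!: Bochner_Integration.integral_cong simp: indicator_def)
    then show "emeasure (density lborel (\<lambda>x. ennreal (h x))) {u<..}
        = emeasure (density lborel (\<lambda>x. ennreal (- h x))) {u<..}"
      unfolding e[OF h] e[OF h'] using zero[of u] by simp
    show "emeasure (density lborel (\<lambda>x. ennreal (h x))) {u<..} < \<infinity>"
      unfolding e[OF h] by simp
  qed auto
  then have "AE x in lborel. ennreal (h x) = ennreal (- h x)"
    by (intro sigma_finite_measure.density_unique[OF lborel.sigma_finite_measure_axioms]) auto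
  then show ?thesis
  proof eventually_elim
    case (elim x)
    then show ?case
      by (cases "h x \<ge> 0") (auto simp: ennreal_neg dest: sym)
  qed
qed

text \<open>
  For test functions \<open>\<psi>\<close> and \<open>\<rho>\<close> the combination \<open>(\<integral>\<rho>) \<psi> - (\<integral>\<psi>) \<rho>\<close> has integral zero and is therefore
  the derivative of a test function. So \<open>\<psi> \<mapsto> \<integral> g \<psi>\<close> is proportional to \<open>\<psi> \<mapsto> \<integral> \<psi>\<close>, and the
  proportionality factor is the constant value of \<open>g\<close>.
\<close>
lemma du_Bois_Reymond:
  fixes g :: "real \<Rightarrow> real"
  assumes ab: "a < b" and g: "set_integrable lborel {a<..<b} g"
    and zero: "\<And>\<phi>. test_function {a<..<b} \<phi> \<Longrightarrow> (LBINT x:{a<..<b}. g x * deriv \<phi> x) = 0"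
  obtains c where "AE x in lborel. x \<in> {a<..<b} \<longrightarrow> g x = c"
proof -
  define J where "J \<psi> = (LBINT x:{a<..<b}. \<psi> x)" for \<psi> :: "real \<Rightarrow> real"
  define L where "L \<psi> = (LBINT x:{a<..<b}. g x * \<psi> x)" for \<psi> :: "real \<Rightarrow> real"
  have limit: "(\<lambda>n. \<integral>x. f x * bump (Suc n) u v x \<partial>lborel) \<longlonglongrightarrow> (\<integral>x. f x * indicator {u<..<v} x \<partial>lborel)"
    if f: "integrable lborel f" for f u v
  proof (rule integral_dominated_convergence[where w="\<lambda>x. \<bar>f x\<bar>"])
    have [measurable]: "bump n u v \<in> borel_measurable borel" for n
      by (intro smooth_measurable smooth_bump)
    have [measurable]: "f \<in> borel_measurable borel" using f by auto
    show "(\<lambda>x. f x * indicator {u<..<v} x) \<in> borel_measurable lborel"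
      "(\<lambda>x. f x * bump (Suc n) u v x) \<in> borel_measurable lborel" for n by auto
    show "AE x in lborel. (\<lambda>n. f x * bump (Suc n) u v x) \<longlonglongrightarrow> f x * indicator {u<..<v} x"
      by (intro AE_I2 tendsto_intros LIMSEQ_Suc bump_tendsto_indicator)
    show "AE x in lborel. norm (f x * bump (Suc n) u v x) \<le> \<bar>f x\<bar>" for n
      by (intro AE_I2) (auto simp: abs_mult bump_range intro!: mult_right_le_one_le)
  qed (use f in auto)
  have proportional: "J \<rho> * L \<psi> = J \<psi> * L \<rho>" if \<psi>: "test_function {a<..<b} \<psi>" and \<rho>: "test_function {a<..<b} \<rho>" for \<psi> \<rho>
  proof -
    note t = set_integrable_test_function[OF _ ab] set_integrable_mult_test_function[OF _ ab g]
    have lin: "J (\<lambda>x. s * \<psi> x + t * \<rho> x) = s * J \<psi> + t * J \<rho>"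
      "L (\<lambda>x. s * \<psi> x + t * \<rho> x) = s * L \<psi> + t * L \<rho>" for s t
      unfolding J_def L_def
      using t[OF \<psi>] t[OF \<rho>]
      by (simp_all add: set_integral_add distrib_left mult.left_commute)
    define \<eta> where "\<eta> = (\<lambda>x. J \<rho> * \<psi> x + (- J \<psi>) * \<rho> x)"
    have "test_function {a<..<b} \<eta>"
      unfolding \<eta>_def by (intro test_function_linear_combination \<psi> \<rho> ab)
    moreover have "J \<eta> = 0"
      unfolding \<eta>_def lin by simp
    ultimately obtain \<phi> where "test_function {a<..<b} \<phi>" "deriv \<phi> = \<eta>"
      using test_function_antiderivative[OF _ ab] unfolding J_def by blast
    then have "L \<eta> = 0"
      using zero unfolding L_def by blast
    then show ?thesis
      unfolding \<eta>_def lin by simp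
  qed
  have "(\<lambda>n. J (bump (Suc n) a b)) \<longlonglongrightarrow> (\<integral>x. indicator {a<..<b} x * indicator {a<..<b} x \<partial>lborel)"
    unfolding J_def set_lebesgue_integral_def real_scaleR_def using ab by (intro limit) simp
  also have "(\<integral>x. indicat_real {a<..<b} x * indicator {a<..<b} x \<partial>lborel) = b - a"
    using ab by (simp flip: indicator_inter_arith)
  finally have "\<forall>\<^sub>F n in sequentially. J (bump (Suc n) a b) > 0"
    using ab by (intro order_tendstoD(1)) auto
  then obtain n0 where n0: "J (bump (Suc n0) a b) > 0"
    by (auto simp: eventually_sequentially)
  define \<rho> where "\<rho> = bump (Suc n0) a b"
  have \<rho>: "test_function {a<..<b} \<rho>" "J \<rho> \<noteq> 0"
    using n0 by (auto simp: \<rho>_def intro: test_function_bump)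
  define c where "c = L \<rho> / J \<rho>"
  have Lc: "L \<psi> = c * J \<psi>" if "test_function {a<..<b} \<psi>" for \<psi>
    using proportional[OF that \<rho>(1)] \<rho>(2) by (simp add: c_def field_simps)
  define h where "h x = indicator {a<..<b} x * (g x - c)" for x
  have h: "integrable lborel h"
  proof -
    have "integrable lborel (\<lambda>x. indicator {a<..<b} x *\<^sub>R g x - c * indicator {a<..<b} x)"
      using g ab unfolding set_integrable_def by (intro Bochner_Integration.integrable_diff integrable_mult_right) auto
    then show ?thesis by (simp add: h_def[abs_def] algebra_simps)
  qed
  have h0: "(\<integral>x. h x * indicator {u<..<v} x \<partial>lborel) = 0" if "a \<le> u" "v \<le> b" for u v
  proof -
    have "(\<integral>x. h x * bump (Suc n) u v x \<partial>lborel) = 0" for n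
    proof -
      have t: "test_function {a<..<b} (bump (Suc n) u v)"
        using that by (intro test_function_bump) auto
      have "(\<integral>x. h x * bump (Suc n) u v x \<partial>lborel) = L (bump (Suc n) u v) - c * J (bump (Suc n) u v)"
        unfolding L_def J_def set_integral_mult_right[symmetric]
        using set_integrable_test_function[OF t ab] set_integrable_mult_test_function[OF t ab g]
        by (subst set_integral_diff(2)[symmetric])
          (auto simp: set_lebesgue_integral_def h_def algebra_simps intro!: Bochner_Integration.integral_cong)
      then show ?thesis using Lc[OF t] by simp
    qed
    then show ?thesis
      using limit[OF h, of u v] by (simp add: LIMSEQ_const_iff)
  qed
  have "AE x in lborel. h x = 0"
  proof (rule AE_zero_of_zero_tail_integrals[OF h])
    fix u
    have "(\<integral>x. indicator {u<..} x * h x \<partial>lborel) = (\<integral>x. h x * indicator {max a u<..<b} x \<partial>lborel)"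
      by (intro Bochner_Integration.integral_cong) (auto simp: h_def indicator_def)
    then show "(\<integral>x. indicator {u<..} x * h x \<partial>lborel) = 0"
      using h0[of "max a u" b] by simp
  qed
  then have "AE x in lborel. x \<in> {a<..<b} \<longrightarrow> g x = c"
    by eventually_elim (auto simp: h_def)
  then show ?thesis by (rule that)
qed

section \<open>Functions of bounded variation have a right limit\<close>

lemma deriv_eq_0_off_support:
  fixes \<phi> :: "real \<Rightarrow> real"
  assumes "closed S" and zero: "\<And>x. x \<notin> S \<Longrightarrow> \<phi> x = 0" and "x \<notin> S"
  shows "deriv \<phi> x = 0"
proof -
  have "\<forall>\<^sub>F y in nhds x. y \<in> - S"
    using assms by (intro eventually_nhds_in_open) auto
  then have "\<forall>\<^sub>F y in nhds x. \<phi> y = 0"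
    by eventually_elim (use zero in auto)
  then show ?thesis
    using deriv_cong_ev[of \<phi> "\<lambda>_. 0" x x] by simp
qed

lemma test_function_deriv:
  assumes "test_function {a<..<b} \<phi>" "a < b"
  shows "test_function {a<..<b} (deriv \<phi>)"
proof -
  obtain c d where cd: "a < c" "c < d" "d < b" "\<And>x. x \<notin> {c..d} \<Longrightarrow> \<phi> x = 0"
    using test_function_support[OF assms] by blast
  show ?thesis
  proof (rule test_functionI[of _ c d])
    show "smooth (deriv \<phi>)"
      using test_function_smooth[OF assms(1)] smooth_iff_deriv by blast
    show "deriv \<phi> x = 0" if "x \<notin> {c..d}" for x
      by (rule deriv_eq_0_off_support[of "{c..d}"]) (use cd(4) that in auto)
  qed (use cd in auto)
qed

text \<open>
  The distributional derivative of a distribution function is its measure. This is Fubini's theorem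
  for \<open>cdf Q x = \<integral> 1\<^sub>{\<^sub>t\<^sub>\<le>\<^sub>x\<^sub>} Q(dt)\<close>: integrating \<open>\<phi>'\<close> over \<open>x \<ge> t\<close> gives \<open>- \<phi> t\<close>.
\<close>
lemma integral_cdf_deriv_test_function:
  assumes Q: "finite_borel_measure Q" and I: "AE t in Q. t \<in> {a<..<b}"
    and \<phi>: "test_function {a<..<b} \<phi>" and ab: "a < b"
  shows "(LBINT x:{a<..<b}. cdf Q x * deriv \<phi> x) = - (\<integral>t. \<phi> t \<partial>Q)"
proof -
  interpret Q: finite_borel_measure Q by fact
  interpret pair_sigma_finite lborel Q
    by (simp add: pair_sigma_finite_def lborel.sigma_finite_measure_axioms Q.sigma_finite_measure_axioms)
  note sQ[measurable_cong] = Q.M_is_borel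
  note s = test_function_smooth[OF \<phi>]
  note d = test_function_deriv[OF \<phi> ab]
  have [measurable]: "deriv \<phi> \<in> borel_measurable borel"
    by (intro smooth_measurable test_function_smooth[OF d])
  obtain u v where uv: "a < u" "u < v" "v < b" "\<And>x. x \<notin> {u..v} \<Longrightarrow> \<phi> x = 0"
    using test_function_support[OF \<phi> ab] by blast
  define k where "k x t = indicator {a<..<b} x * indicator {t..} x * deriv \<phi> x" for x t
  have k_eq: "k x t = (indicator {a<..<b} x * deriv \<phi> x) * indicator {..x} t" for x t
    by (auto simp: k_def indicator_def)
  have km[measurable]: "case_prod k \<in> borel_measurable (lborel \<Otimes>\<^sub>M Q)"
  proof -
    have "case_prod k = (\<lambda>p. (indicator {a<..<b} (fst p) * deriv \<phi> (fst p)) * (if snd p \<le> fst p then 1 else 0))"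
      by (auto simp: k_eq indicator_def)
    moreover have "\<dots> \<in> borel_measurable (lborel \<Otimes>\<^sub>M Q)" by measurable
    ultimately show ?thesis by metis
  qed
  have dI: "integrable lborel (\<lambda>x. indicator {a<..<b} x * deriv \<phi> x)"
    using set_integrable_test_function[OF d ab] by (simp add: set_integrable_def)
  have inner: "(\<integral>t. k x t \<partial>Q) = indicator {a<..<b} x * deriv \<phi> x * cdf Q x" for x
    unfolding k_eq by (simp add: cdf_def sQ)
  have int: "integrable (lborel \<Otimes>\<^sub>M Q) (case_prod k)"
  proof (rule Fubini_integrable)
    have "(\<lambda>x. \<integral>t. norm (case_prod k (x, t)) \<partial>Q) = (\<lambda>x. \<bar>indicator {a<..<b} x * deriv \<phi> x\<bar> * cdf Q x)"
    proof
      fix x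
      have "(\<lambda>t. norm (case_prod k (x, t))) = (\<lambda>t. \<bar>indicator {a<..<b} x * deriv \<phi> x\<bar> * indicator {..x} t)"
        by (auto simp: k_eq abs_mult)
      then show "(\<integral>t. norm (case_prod k (x, t)) \<partial>Q) = \<bar>indicator {a<..<b} x * deriv \<phi> x\<bar> * cdf Q x"
        by (simp add: cdf_def sQ)
    qed
    moreover have "integrable lborel (\<lambda>x. \<bar>indicator {a<..<b} x * deriv \<phi> x\<bar> * cdf Q x)"
    proof (rule Bochner_Integration.integrable_bound)
      show "integrable lborel (\<lambda>x. measure Q (space Q) * (indicator {a<..<b} x * deriv \<phi> x))"
        using dI by simp
      have [measurable]: "cdf Q \<in> borel_measurable borel"
        by (intro borel_measurable_mono monoI Q.cdf_nondecreasing)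
      show "(\<lambda>x. \<bar>indicator {a<..<b} x * deriv \<phi> x\<bar> * cdf Q x) \<in> borel_measurable lborel"
        by measurable
      show "AE x in lborel. norm (\<bar>indicator {a<..<b} x * deriv \<phi> x\<bar> * cdf Q x)
          \<le> norm (measure Q (space Q) * (indicator {a<..<b} x * deriv \<phi> x))"
        using Q.cdf_bounded Q.cdf_nonneg
        by (intro AE_I2) (auto simp: abs_mult mult.commute[of "measure Q _"] intro!: mult_left_mono)
    qed
    ultimately show "integrable lborel (\<lambda>x. \<integral>t. norm (case_prod k (x, t)) \<partial>Q)" by simp
    show "AE x in lborel. integrable Q (\<lambda>t. case_prod k (x, t))"
    proof (rule AE_I2)
      fix x
      have "integrable Q (\<lambda>t. (indicator {a<..<b} x * deriv \<phi> x) * indicator {..x} t)"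
        by (intro integrable_mult_right integrable_real_indicator) (auto simp: sQ less_top[symmetric])
      then show "integrable Q (\<lambda>t. case_prod k (x, t))"
        by (simp add: k_eq)
    qed
  qed (rule km)
  have outer: "(\<integral>x. k x t \<partial>lborel) = - \<phi> t" if t: "t \<in> {a<..<b}" for t
  proof -
    \<comment> \<open>For \<open>t\<close> to the right of the support, \<open>max t v\<close> keeps the interval nonempty.\<close>
    have "(\<integral>x. k x t \<partial>lborel) = (\<integral>x. deriv \<phi> x * indicator {t..max t v} x \<partial>lborel)"
    proof (intro Bochner_Integration.integral_cong refl)
      fix x
      have "x > v \<Longrightarrow> deriv \<phi> x = 0"
        using deriv_eq_0_off_support[of "{u..v}" \<phi> x] uv(4) by auto
      then show "k x t = deriv \<phi> x * indicator {t..max t v} x"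
        using t uv by (auto simp: k_def indicator_def max_def)
    qed
    also have "\<dots> = \<phi> (max t v) - \<phi> t"
      using smooth_DERIV[OF s] smooth_continuous_on[OF test_function_smooth[OF d], of UNIV]
      by (intro integral_FTC_Icc_real) (auto simp: continuous_on_eq_continuous_at)
    also have "\<phi> (max t v) = 0"
    proof (cases "t > v")
      case False
      have "isCont \<phi> v" using smooth_DERIV[OF s] DERIV_isCont by blast
      then have "(\<phi> \<longlongrightarrow> \<phi> v) (at_right v)"
        using continuous_at_imp_continuous_at_within continuous_within by blast
      moreover have "(\<phi> \<longlongrightarrow> 0) (at_right v)"
        by (rule tendsto_eventually) (use uv in \<open>auto intro!: eventually_at_rightI[of v "v + 1"]\<close>)
      ultimately have "\<phi> v = 0" by (intro tendsto_unique[of "at_right v"]) auto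
      then show ?thesis using False by (simp add: max_def)
    qed (use uv in auto)
    finally show ?thesis by simp
  qed
  have "(LBINT x:{a<..<b}. cdf Q x * deriv \<phi> x) = (\<integral>x. (\<integral>t. k x t \<partial>Q) \<partial>lborel)"
    unfolding inner set_lebesgue_integral_def by (simp add: mult_ac)
  also have "\<dots> = (\<integral>t. (\<integral>x. k x t \<partial>lborel) \<partial>Q)"
    by (rule Fubini_integral[OF int, symmetric])
  also have "\<dots> = (\<integral>t. - \<phi> t \<partial>Q)"
  proof (rule integral_cong_AE)
    have [measurable]: "\<phi> \<in> borel_measurable borel" by (rule smooth_measurable[OF s])
    show "(\<lambda>t. - \<phi> t) \<in> borel_measurable Q" by measurable
    show "AE t in Q. (\<integral>x. k x t \<partial>lborel) = - \<phi> t"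
      using I by eventually_elim (rule outer)
  qed measurable
  finally show ?thesis by simp
qed

text \<open>
  The parts of a Jordan decomposition live on the trace of the Borel sets on an interval; their
  images on the whole line have distribution functions.
\<close>
lemma distr_jordan_part:
  assumes "finite_measure M" "sets M = sets (restrict_space borel {a<..<b::real})"
  defines "Q \<equiv> distr M borel (\<lambda>x. x)"
  shows "finite_borel_measure Q" "AE t in Q. t \<in> {a<..<b}"
    "\<phi> \<in> borel_measurable borel \<Longrightarrow> (\<integral>t. \<phi> t \<partial>Q) = (\<integral>t. (\<phi> t :: real) \<partial>M)"
proof -
  have m[measurable]: "(\<lambda>x. x) \<in> measurable M borel"
    unfolding measurable_cong_sets[OF assms(2) refl]
    by (intro measurable_restrict_space1) simp
  have sp: "space M = {a<..<b}"
    using sets_eq_imp_space_eq[OF assms(2)] by (simp add: space_restrict_space)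
  interpret M: finite_measure M by fact
  show "finite_borel_measure Q"
    unfolding Q_def finite_borel_measure_def finite_borel_measure_axioms_def
    using M.finite_measure_distr[OF m] by simp
  have "AE t in M. t \<in> {a<..<b}"
    by (rule AE_I2) (simp add: sp)
  then show "AE t in Q. t \<in> {a<..<b}"
    unfolding Q_def by (subst AE_distr_iff) auto
  show "(\<integral>t. \<phi> t \<partial>Q) = (\<integral>t. \<phi> t \<partial>M)" if "\<phi> \<in> borel_measurable borel"
    unfolding Q_def by (rule integral_distr[OF m that])
qed

lemma set_integrable_cdf_Ioo:
  assumes "finite_borel_measure Q" "a < (b::real)"
  shows "set_integrable lborel {a<..<b} (cdf Q)"
proof -
  interpret Q: finite_borel_measure Q by fact
  have [measurable]: "cdf Q \<in> borel_measurable borel"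
    by (intro borel_measurable_mono monoI Q.cdf_nondecreasing)
  show ?thesis
    unfolding set_integrable_def real_scaleR_def
  proof (rule Bochner_Integration.integrable_bound)
    show "integrable lborel (\<lambda>x. measure Q (space Q) * indicator {a<..<b} x)"
      using assms(2) by simp
    show "AE x in lborel. norm (indicator {a<..<b} x * cdf Q x) \<le> norm (measure Q (space Q) * indicator {a<..<b} x)"
      using Q.cdf_bounded Q.cdf_nonneg by (intro AE_I2) (auto simp: indicator_def)
  qed measurable
qed

text \<open>
  \<open>f\<close> and the difference of the distribution functions of the two Jordan parts of \<open>Df\<close> have the same
  distributional derivative, so they differ by a constant almost everywhere.
\<close>
lemma BV_version_with_one_sided_limits:
  assumes "BV a b f" and ab: "a < b"
  obtains g where "AE y in lborel. y \<in> {a<..<b} \<longrightarrow> g y = f y"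
    and "\<And>y. \<exists>l. (g \<longlongrightarrow> l) (at_left y)" and "\<And>y. \<exists>r. (g \<longlongrightarrow> r) (at_right y)"
proof -
  obtain m where f: "set_integrable lborel {a..b} f" and "is_distributional_derivative {a<..<b} f m"
    using assms(1) unfolding BV_def by blast
  then obtain P N where J: "jordan_decomposition {a<..<b} m P N"
    and D: "\<And>\<phi>. test_function {a<..<b} \<phi> \<Longrightarrow>
      (LBINT x:{a<..<b}. f x * deriv \<phi> x) = - ((\<integral>x. \<phi> x \<partial>P) - (\<integral>x. \<phi> x \<partial>N))"
    unfolding is_distributional_derivative_def by blast
  define P' where "P' = distr P borel (\<lambda>x. x)"
  define N' where "N' = distr N borel (\<lambda>x. x)"
  have "finite_measure P" "sets P = sets (restrict_space borel {a<..<b})"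
    "finite_measure N" "sets N = sets (restrict_space borel {a<..<b})"
    using J unfolding jordan_decomposition_def by auto
  note P' = distr_jordan_part[OF this(1,2), folded P'_def]
    and N' = distr_jordan_part[OF this(3,4), folded N'_def]
  note iP = set_integrable_cdf_Ioo[OF P'(1) ab] and iN = set_integrable_cdf_Ioo[OF N'(1) ab]
  have f': "set_integrable lborel {a<..<b} f"
    by (rule set_integrable_subset[OF f]) auto
  have "set_integrable lborel {a<..<b} (\<lambda>x. f x - cdf P' x + cdf N' x)"
    using f' iP iN by (intro set_integral_add set_integral_diff) auto
  moreover have "(LBINT x:{a<..<b}. (f x - cdf P' x + cdf N' x) * deriv \<phi> x) = 0"
    if \<phi>: "test_function {a<..<b} \<phi>" for \<phi>
  proof -
    note d = test_function_deriv[OF \<phi> ab]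
    note i = set_integrable_mult_test_function[OF d ab]
    have "(LBINT x:{a<..<b}. (f x - cdf P' x + cdf N' x) * deriv \<phi> x) =
        (LBINT x:{a<..<b}. f x * deriv \<phi> x - cdf P' x * deriv \<phi> x + cdf N' x * deriv \<phi> x)"
      by (simp add: algebra_simps)
    also have "\<dots> = (LBINT x:{a<..<b}. f x * deriv \<phi> x) - (LBINT x:{a<..<b}. cdf P' x * deriv \<phi> x)
        + (LBINT x:{a<..<b}. cdf N' x * deriv \<phi> x)"
      using i[OF f'] i[OF iP] i[OF iN] by (simp add: set_integral_add set_integral_diff)
    also have "\<dots> = 0"
      using D[OF \<phi>] integral_cdf_deriv_test_function[OF P'(1,2) \<phi> ab]
        integral_cdf_deriv_test_function[OF N'(1,2) \<phi> ab]
        P'(3)[of \<phi>] N'(3)[of \<phi>] smooth_measurable[OF test_function_smooth[OF \<phi>]]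
      by simp
    finally show ?thesis .
  qed
  ultimately obtain c where c: "AE x in lborel. x \<in> {a<..<b} \<longrightarrow> f x - cdf P' x + cdf N' x = c"
    using du_Bois_Reymond[OF ab] by blast
  define g where "g x = c + cdf P' x - cdf N' x" for x
  show ?thesis
  proof (rule that[of g])
    show "AE y in lborel. y \<in> {a<..<b} \<longrightarrow> g y = f y"
      using c by eventually_elim (auto simp: g_def)
    fix y
    show "\<exists>l. (g \<longlongrightarrow> l) (at_left y)"
      using tendsto_diff[OF tendsto_add[OF tendsto_const[of c]
          finite_borel_measure.cdf_at_left[OF P'(1), of y]]
          finite_borel_measure.cdf_at_left[OF N'(1), of y]]
      unfolding g_def by blast
    show "\<exists>r. (g \<longlongrightarrow> r) (at_right y)"
      using tendsto_diff[OF tendsto_add[OF tendsto_const[of c]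
          finite_borel_measure.cdf_is_right_cont[OF P'(1), of y, unfolded continuous_within]]
          finite_borel_measure.cdf_is_right_cont[OF N'(1), of y, unfolded continuous_within]]
      unfolding g_def by blast
  qed
qed

text \<open>
  Two functions that agree almost everywhere agree at points arbitrarily close to \<open>a\<close>.
\<close>
lemma tendsto_at_right_unique_AE:
  fixes g h :: "real \<Rightarrow> real"
  assumes ab: "a < b" and eq: "AE y in lborel. y \<in> {a<..<b} \<longrightarrow> g y = h y"
    and g: "(g \<longlongrightarrow> L) (at_right a)" and h: "(h \<longlongrightarrow> M) (at_right a)"
  shows "L = M"
proof (rule ccontr)
  assume "L \<noteq> M"
  have "((\<lambda>y. \<bar>g y - h y\<bar>) \<longlongrightarrow> \<bar>L - M\<bar>) (at_right a)"
    by (intro tendsto_intros g h)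
  then have "\<forall>\<^sub>F y in at_right a. 0 < \<bar>g y - h y\<bar>"
    by (rule order_tendstoD) (use \<open>L \<noteq> M\<close> in auto)
  then obtain c where c: "a < c" "\<And>y. a < y \<Longrightarrow> y < c \<Longrightarrow> 0 < \<bar>g y - h y\<bar>"
    unfolding eventually_at_right_field by blast
  have "AE y in lborel. y \<notin> {a<..<min b c}"
    using eq by eventually_elim (use c(2) in auto)
  then have "emeasure lborel {a<..<min b c} = 0"
    by (subst (asm) AE_iff_measurable[of "{a<..<min b c}"]) auto
  then show False using ab c(1) by simp
qed

text \<open>
  The definite description behind \<open>right_limit\<close> is proper for functions of bounded variation.
\<close>
lemma right_limit_BV:
  assumes "BV a b f" "a < b"
  obtains g where "AE y in lborel. y \<in> {a<..<b} \<longrightarrow> g y = f y"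
    and "(g \<longlongrightarrow> right_limit a b f a) (at_right a)"
proof -
  define Q where "Q L \<longleftrightarrow> (\<exists>g. (AE y in lborel. y \<in> {a<..<b} \<longrightarrow> g y = f y) \<and>
        (\<forall>y\<in>{a<..<b}. (\<exists>l. (g \<longlongrightarrow> l) (at_left y)) \<and> (\<exists>r. (g \<longlongrightarrow> r) (at_right y))) \<and>
        (g \<longlongrightarrow> L) (at_right a))" for L
  obtain g where g: "AE y in lborel. y \<in> {a<..<b} \<longrightarrow> g y = f y"
      "\<And>y. \<exists>l. (g \<longlongrightarrow> l) (at_left y)" "\<And>y. \<exists>r. (g \<longlongrightarrow> r) (at_right y)"
    using BV_version_with_one_sided_limits[OF assms] by blast
  then obtain L where L: "(g \<longlongrightarrow> L) (at_right a)" by blast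
  have "Q L" unfolding Q_def using g L by blast
  moreover have "M = L" if "Q M" for M
  proof -
    obtain h where h: "AE y in lborel. y \<in> {a<..<b} \<longrightarrow> h y = f y" "(h \<longlongrightarrow> M) (at_right a)"
      using \<open>Q M\<close> unfolding Q_def by (elim exE conjE)
    have "AE y in lborel. y \<in> {a<..<b} \<longrightarrow> h y = g y"
      using h(1) g(1) by eventually_elim auto
    then show "M = L" using tendsto_at_right_unique_AE[OF assms(2) _ h(2) L] by blast
  qed
  ultimately have "Q (THE L. Q L)" by (rule theI)
  then have "Q (right_limit a b f a)"
    unfolding right_limit_def Q_def .
  then show ?thesis unfolding Q_def by (elim exE conjE) (rule that)
qed

section \<open>Decay of the characteristic function\<close>

text \<open>
  The sets \<open>A\<close> and \<open>-A\<close> overlap at most in 0, which \<open>\<nu>\<close> does not charge. As an image measure,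
  \<open>\<nu>\<^sub>s\<close> turns integrals of even functions against \<open>\<nu>\<close> into integrals over the half-line.
\<close>

lemma symmetrized_jump_measure_eq_distr:
  assumes s: "sets \<nu> = sets borel" and z: "emeasure \<nu> {0} = 0"
  shows "symmetrized_jump_measure \<nu> = distr \<nu> (restrict_space borel {0..}) abs"
proof (rule measure_eqI)
  show sets: "sets (symmetrized_jump_measure \<nu>) = sets (distr \<nu> (restrict_space borel {0..}) abs)"
    unfolding sets_symmetrized_jump_measure by (simp add: borel_subsets_eq)
  note [measurable_cong] = s
  fix A assume "A \<in> sets (symmetrized_jump_measure \<nu>)"
  then have A: "A \<in> sets borel" "A \<subseteq> {0..}"
    by (auto simp: sets_symmetrized_jump_measure)
  have sp: "space \<nu> = UNIV" using sets_eq_imp_space_eq[OF s] by simp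
  have "abs \<in> measurable \<nu> (restrict_space borel {0..})"
    by (intro measurable_restrict_space2) auto
  moreover have "A \<in> sets (restrict_space borel {0..})"
    using A by (simp add: borel_subsets_eq[symmetric])
  ultimately have "emeasure (distr \<nu> (restrict_space borel {0..}) abs) A = emeasure \<nu> (abs -` A)"
    by (simp add: emeasure_distr sp)
  also have "abs -` A = A \<union> uminus ` A"
  proof (intro equalityI subsetI)
    fix x assume "x \<in> abs -` A"
    then show "x \<in> A \<union> uminus ` A"
      by (cases "x \<ge> 0") (auto intro: image_eqI[of _ _ "- x"])
  qed (use A(2) in auto)
  also have "emeasure \<nu> \<dots> = emeasure \<nu> A + emeasure \<nu> (uminus ` A)"
  proof (rule emeasure_Un')
    have "uminus ` A = uminus -` A \<inter> space borel"
      by (auto simp: image_iff) (metis minus_minus)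
    then show "uminus ` A \<in> sets \<nu>"
      using measurable_sets[OF borel_measurable_uminus[OF measurable_ident] A(1)] s by simp
    then have "A \<inter> uminus ` A \<in> sets \<nu>" using A s by auto
    moreover have "A \<inter> uminus ` A \<subseteq> {0}"
    proof
      fix x assume "x \<in> A \<inter> uminus ` A"
      then have "x \<in> A" "- x \<in> A" by auto
      then have "0 \<le> x" "0 \<le> - x" using A(2) by (metis atLeast_iff subsetD)+
      then show "x \<in> {0}" by simp
    qed
    ultimately show "A \<inter> uminus ` A \<in> null_sets \<nu>"
      using emeasure_mono[of "A \<inter> uminus ` A" "{0}" \<nu>] z s by (auto intro!: null_setsI)
  qed (use A s in auto)
  finally show "emeasure (symmetrized_jump_measure \<nu>) A = emeasure (distr \<nu> (restrict_space borel {0..}) abs) A"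
    using emeasure_symmetrized_jump_measure[OF s A] by simp
qed

lemma nn_integral_symmetrized_density:
  fixes F :: "real \<Rightarrow> ennreal"
  assumes s: "sets \<nu> = sets borel" and z: "emeasure \<nu> {0} = 0"
    and k: "admits_density_on (density (symmetrized_jump_measure \<nu>) (\<lambda>x. ennreal x)) {0<..\<delta>} k"
    and [measurable]: "F \<in> borel_measurable borel"
  shows "(\<integral>\<^sup>+x. ennreal \<bar>x\<bar> * indicator {0<..\<delta>} \<bar>x\<bar> * F \<bar>x\<bar> \<partial>\<nu>)
    = (\<integral>\<^sup>+x\<in>{0<..\<delta>}. ennreal (k x) * F x \<partial>lborel)"
proof -
  let ?S = "symmetrized_jump_measure \<nu>"
  note [measurable_cong] = s
  have [measurable]: "(\<lambda>x. indicat_real {0<..\<delta>} x * k x) \<in> borel_measurable borel"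
    using k unfolding admits_density_on_def set_borel_measurable_def by simp
  define M1 where "M1 = distr (density \<nu> (\<lambda>x. ennreal \<bar>x\<bar> * indicator {0<..\<delta>} \<bar>x\<bar>)) borel abs"
  define M2 where "M2 = density lborel (\<lambda>x. ennreal (indicat_real {0<..\<delta>} x * k x))"
  \<comment> \<open>Both sides are integrals of \<open>F\<close>; it suffices that the two underlying measures on the line agree.\<close>
  have "M1 = M2"
  proof (rule measure_eqI)
    fix A assume "A \<in> sets M1"
    then have A[measurable]: "A \<in> sets borel" by (simp add: M1_def)
    define B where "B = A \<inter> {0<..\<delta>}"
    have B[measurable]: "B \<in> sets borel" "B \<subseteq> {0..}" by (auto simp: B_def)
    have m: "abs \<in> measurable \<nu> (restrict_space borel {0..})"
      by (intro measurable_restrict_space2) auto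
    have "emeasure M1 A = (\<integral>\<^sup>+x. ennreal \<bar>x\<bar> * indicator B \<bar>x\<bar> \<partial>\<nu>)"
      unfolding M1_def
      by (subst emeasure_distr)
        (auto simp: emeasure_density B_def indicator_def intro!: nn_integral_cong)
    also have "\<dots> = (\<integral>\<^sup>+x. ennreal x * indicator B x \<partial>?S)"
      unfolding symmetrized_jump_measure_eq_distr[OF s z]
      by (subst nn_integral_distr[OF m]) (auto intro!: measurable_restrict_space1)
    also have "\<dots> = emeasure (density ?S (\<lambda>x. ennreal x)) B"
    proof (subst emeasure_density)
      show "(\<lambda>x. ennreal x) \<in> borel_measurable ?S"
        unfolding symmetrized_jump_measure_eq_distr[OF s z]
        by (auto intro!: measurable_restrict_space1)
      show "B \<in> sets ?S"
        using B by (simp add: sets_symmetrized_jump_measure)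
    qed simp
    also have "\<dots> = (\<integral>\<^sup>+x\<in>B. ennreal (k x) \<partial>lborel)"
      using k B unfolding admits_density_on_def B_def by blast
    also have "\<dots> = emeasure M2 A"
      unfolding M2_def
    proof (subst emeasure_density)
      show "(\<lambda>x. ennreal (indicat_real {0<..\<delta>} x * k x)) \<in> borel_measurable lborel"
        by measurable
    qed (auto intro!: nn_integral_cong simp: B_def indicator_def)
    finally show "emeasure M1 A = emeasure M2 A" .
  qed (simp add: M1_def M2_def)
  have "(\<integral>\<^sup>+x. ennreal \<bar>x\<bar> * indicator {0<..\<delta>} \<bar>x\<bar> * F \<bar>x\<bar> \<partial>\<nu>) = (\<integral>\<^sup>+x. F x \<partial>M1)"
    unfolding M1_def by (subst nn_integral_distr) (auto simp: nn_integral_density)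
  also have "\<dots> = (\<integral>\<^sup>+x\<in>{0<..\<delta>}. ennreal (k x) * F x \<partial>lborel)"
  proof -
    have "(\<integral>\<^sup>+x. F x \<partial>M2) = (\<integral>\<^sup>+x. ennreal (indicat_real {0<..\<delta>} x * k x) * F x \<partial>lborel)"
      unfolding M2_def by (rule nn_integral_density) measurable
    also have "\<dots> = (\<integral>\<^sup>+x\<in>{0<..\<delta>}. ennreal (k x) * F x \<partial>lborel)"
      by (auto intro!: nn_integral_cong simp: indicator_def)
    finally show ?thesis unfolding \<open>M1 = M2\<close> .
  qed
  finally show ?thesis .
qed

text \<open>
  The integral of \<open>1 / x\<close> produces the logarithm. Integrating \<open>cos (u x) / x\<close> by parts leaves
  \<open>sin (u x) / (u x)\<close> and an integral of \<open>sin (u x) / (u x\<^sup>2)\<close>, which is estimated by \<open>sin \<le> 1\<close>. The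
  function \<open>H\<close> below collects the resulting antiderivatives.
\<close>
lemma integral_one_minus_cos_over_x_lower_bound:
  fixes u \<eta> :: real
  assumes u: "0 < u" and \<eta>: "1 / u \<le> \<eta>"
  shows "ennreal (ln (u * \<eta>) - 1) \<le> (\<integral>\<^sup>+x\<in>{1 / u..\<eta>}. ennreal ((1 - cos (u * x)) / x) \<partial>lborel)"
proof -
  have pos: "x > 0" if "1 / u \<le> x" for x
    using that u by (metis less_le_trans zero_less_divide_1_iff)
  define H where "H x = ln x - sin (u * x) / (u * x) + 1 / (u * x)" for x
  define h where "h x = (1 - cos (u * x)) / x + (sin (u * x) - 1) / (u * x\<^sup>2)" for x
  have H: "(H has_real_derivative h x) (at x)" if "x > 0" for x
    unfolding H_def h_def using that u
    by (auto intro!: derivative_eq_intros simp: field_simps power2_eq_square)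
  have cont: "isCont h x" "isCont (\<lambda>x. (1 - cos (u * x)) / x) x" if "x > 0" for x
    unfolding h_def using that u by (auto intro!: continuous_intros)
  have i: "integrable lborel (\<lambda>x. (1 - cos (u * x)) / x * indicator {1 / u..\<eta>} x)"
    by (intro borel_integrable_atLeastAtMost cont(2) pos)
  have "ln (u * \<eta>) - 1 \<le> H \<eta> - H (1 / u)"
  proof -
    have "sin (u * \<eta>) / (u * \<eta>) \<le> 1 / (u * \<eta>)"
      using u pos[OF \<eta>] by (intro divide_right_mono) auto
    moreover have "ln (u * \<eta>) = ln u + ln \<eta>" using u pos[OF \<eta>] by (simp add: ln_mult)
    moreover have "ln (1 / u) = - ln u" using u by (simp add: ln_div)
    moreover have "0 \<le> sin (1 :: real)" by (simp add: sin_ge_zero pi_ge_two[THEN order_trans[rotated]])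
    ultimately show ?thesis using u by (simp add: H_def)
  qed
  also have "\<dots> = (\<integral>x. h x * indicator {1 / u..\<eta>} x \<partial>lborel)"
    using H cont(1) pos by (intro integral_FTC_Icc_real[symmetric] \<eta>) auto
  also have "\<dots> \<le> (\<integral>x. (1 - cos (u * x)) / x * indicator {1 / u..\<eta>} x \<partial>lborel)"
  proof (rule integral_mono[OF _ i])
    show "integrable lborel (\<lambda>x. h x * indicator {1 / u..\<eta>} x)"
      by (rule borel_integrable_atLeastAtMost) (use cont(1) pos in auto)
    show "h x * indicator {1 / u..\<eta>} x \<le> (1 - cos (u * x)) / x * indicator {1 / u..\<eta>} x" for x
      using u by (auto simp: h_def indicator_def divide_nonpos_nonneg)
  qed
  finally have "ennreal (ln (u * \<eta>) - 1) \<le> ennreal (\<integral>x. (1 - cos (u * x)) / x * indicator {1 / u..\<eta>} x \<partial>lborel)"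
    by (rule ennreal_leI)
  also have "\<dots> = (\<integral>\<^sup>+x. ennreal ((1 - cos (u * x)) / x * indicator {1 / u..\<eta>} x) \<partial>lborel)"
    using pos by (intro nn_integral_eq_integral[symmetric, OF i] AE_I2) (auto simp: indicator_def intro!: divide_nonneg_nonneg dest: less_imp_le)
  also have "\<dots> = (\<integral>\<^sup>+x\<in>{1 / u..\<eta>}. ennreal ((1 - cos (u * x)) / x) \<partial>lborel)"
    by (intro nn_integral_cong) (auto simp: indicator_def)
  finally show ?thesis .
qed

text \<open>
  The second-order Taylor estimate on \<open>[-1, 1]\<close> and the bound 2 outside are both at most a multiple of
  \<open>min 1 (x\<^sup>2)\<close>, which a Levy measure integrates.
\<close>
lemma levy_khintchine_integrable:
  assumes "levy_measure \<nu>"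
  shows "complex_integrable \<nu> (\<lambda>x. iexp (u * x) - 1 - \<i> * complex_of_real (u * x * indicator {-1..1} x))"
proof -
  have s[measurable_cong]: "sets \<nu> = sets borel" and fin: "(\<integral>\<^sup>+x. ennreal (min 1 (x\<^sup>2)) \<partial>\<nu>) < \<infinity>"
    using assms unfolding levy_measure_def by auto
  have "integrable \<nu> (\<lambda>x. min 1 (x\<^sup>2))"
    using fin by (intro integrableI_nonneg) auto
  then have "integrable \<nu> (\<lambda>x. (u\<^sup>2 / 2 + 2) * min 1 (x\<^sup>2))" by simp
  then show ?thesis
  proof (rule Bochner_Integration.integrable_bound)
    show "AE x in \<nu>. norm (iexp (u * x) - 1 - \<i> * complex_of_real (u * x * indicator {-1..1} x))
        \<le> norm ((u\<^sup>2 / 2 + 2) * min 1 (x\<^sup>2))"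
    proof (rule AE_I2)
      fix x :: real
      show "norm (iexp (u * x) - 1 - \<i> * complex_of_real (u * x * indicator {-1..1} x))
        \<le> norm ((u\<^sup>2 / 2 + 2) * min 1 (x\<^sup>2))"
      proof (cases "x \<in> {-1..1}")
        case True
        have "cmod (iexp (u * x) - 1 - \<i> * complex_of_real (u * x)) \<le> \<bar>u * x\<bar>\<^sup>2 / 2"
          using iexp_approx1[of "u * x" 1] by (simp add: diff_diff_eq numeral_2_eq_2)
        also have "\<dots> \<le> (u\<^sup>2 / 2 + 2) * x\<^sup>2"
          by (simp add: power_mult_distrib algebra_simps)
        also have "x\<^sup>2 = min 1 (x\<^sup>2)"
          using True by (simp add: abs_square_le_1 abs_le_iff)
        finally show ?thesis using True by simp
      next
        case False
        have "cmod (iexp (u * x) - 1) \<le> 2"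
          using norm_triangle_ineq4[of "iexp (u * x)" 1] by simp
        moreover have "1 \<le> x\<^sup>2" using False abs_square_le_1[of x] by (auto simp: abs_le_iff)
        ultimately show ?thesis using False by (simp add: add_increasing)
      qed
    qed
  qed measurable
qed

lemma norm_char_le_exp_integral:
  assumes "characteristic_triplet \<mu> \<sigma>2 \<gamma> \<nu>"
  shows "integrable \<nu> (\<lambda>x. 1 - cos (u * x))"
    and "cmod (char \<mu> u) \<le> exp (- (\<integral>x. 1 - cos (u * x) \<partial>\<nu>))"
proof -
  let ?g = "\<lambda>x. iexp (u * x) - 1 - \<i> * complex_of_real (u * x * indicator {-1..1} x)"
  have \<sigma>2: "0 \<le> \<sigma>2" and levy: "levy_measure \<nu>" and ch: "char \<mu> u =
        exp (- complex_of_real (\<sigma>2 / 2 * u\<^sup>2) + \<i> * complex_of_real (\<gamma> * u) + (CLINT x|\<nu>. ?g x))"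
    using assms unfolding characteristic_triplet_def by auto
  note g = levy_khintchine_integrable[OF levy, of u]
  have Re: "Re (?g x) = - (1 - cos (u * x))" for x
    by (simp add: Re_exp)
  have "integrable \<nu> (\<lambda>x. Re (?g x))" using g by (rule integrable_Re)
  then have "integrable \<nu> (\<lambda>x. - (1 - cos (u * x)))" unfolding Re .
  then show "integrable \<nu> (\<lambda>x. 1 - cos (u * x))"
    using integrable_minus[of \<nu> "\<lambda>x. - (1 - cos (u * x))"] by simp
  have "Re (CLINT x|\<nu>. ?g x) = (\<integral>x. - (1 - cos (u * x)) \<partial>\<nu>)"
    using integral_Re[OF g] unfolding Re by simp
  then have "cmod (char \<mu> u) = exp (- (\<sigma>2 / 2 * u\<^sup>2) - (\<integral>x. 1 - cos (u * x) \<partial>\<nu>))"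
    unfolding ch by (simp only: norm_exp_eq_Re plus_complex.sel uminus_complex.sel Bochner_Integration.integral_minus) simp
  then show "cmod (char \<mu> u) \<le> exp (- (\<integral>x. 1 - cos (u * x) \<partial>\<nu>))"
    using \<sigma>2 by simp
qed

text \<open>
  By symmetry of the cosine only \<open>\<nu>\<^sub>s\<close> enters. On \<open>[1/\<bar>u\<bar>, \<eta>]\<close> the density of \<open>x \<nu>\<^sub>s(dx)\<close> is bounded
  below by \<open>\<beta>\<close>, which turns the logarithmic lower bound into a power of \<open>\<bar>u\<bar>\<close>.
\<close>
lemma char_polynomial_decay:
  assumes T: "characteristic_triplet \<mu> \<sigma>2 \<gamma> \<nu>"
    and k: "admits_density_on (density (symmetrized_jump_measure \<nu>) (\<lambda>x. ennreal x)) {0<..\<delta>} k"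
    and \<eta>: "0 < \<eta>" "\<eta> \<le> \<delta>" and \<beta>: "0 \<le> \<beta>"
    and low: "AE x in lborel. x \<in> {0<..\<eta>} \<longrightarrow> \<beta> \<le> k x"
    and u: "1 / \<eta> \<le> \<bar>u\<bar>"
  shows "cmod (char \<mu> u) \<le> exp \<beta> * (\<bar>u\<bar> * \<eta>) powr (- \<beta>)"
proof -
  have s[measurable_cong]: "sets \<nu> = sets borel" and z: "emeasure \<nu> {0} = 0"
    using T unfolding characteristic_triplet_def levy_measure_def by auto
  define v where "v = \<bar>u\<bar>"
  have v: "0 < v" "1 / v \<le> \<eta>"
  proof -
    have "0 < 1 / \<eta>" using \<eta> by simp
    then show "0 < v" using u unfolding v_def by linarith
    then show "1 / v \<le> \<eta>" using u \<eta> unfolding v_def by (simp add: field_simps)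
  qed
  have cos: "cos (u * x) = cos (v * \<bar>x\<bar>)" for x
    unfolding v_def by (metis abs_mult cos_abs_real)
  define F where "F x = ennreal ((1 - cos (v * x)) / x)" for x
  have [measurable]: "F \<in> borel_measurable borel" unfolding F_def by measurable
  have "ennreal (\<beta> * (ln (v * \<eta>) - 1)) = ennreal \<beta> * ennreal (ln (v * \<eta>) - 1)"
    using \<beta> by (rule ennreal_mult')
  also have "\<dots> \<le> ennreal \<beta> * (\<integral>\<^sup>+x\<in>{1 / v..\<eta>}. F x \<partial>lborel)"
    unfolding F_def by (intro mult_left_mono integral_one_minus_cos_over_x_lower_bound v) simp
  also have "\<dots> = (\<integral>\<^sup>+x\<in>{1 / v..\<eta>}. ennreal \<beta> * F x \<partial>lborel)"
    by (subst nn_integral_cmult[symmetric]) (auto simp: mult_ac)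
  also have "\<dots> \<le> (\<integral>\<^sup>+x\<in>{0<..\<delta>}. ennreal (k x) * F x \<partial>lborel)"
  proof (rule nn_integral_mono_AE)
    have "0 < 1 / v" using v by simp
    show "AE x in lborel. ennreal \<beta> * F x * indicator {1 / v..\<eta>} x \<le> ennreal (k x) * F x * indicator {0<..\<delta>} x"
      using low
    proof eventually_elim
      case (elim x)
      show ?case
      proof (cases "x \<in> {1 / v..\<eta>}")
        case True
        then have "0 < x" using \<open>0 < 1 / v\<close> by (metis atLeastAtMost_iff less_le_trans)
        with True have "x \<in> {0<..\<eta>}" by simp
        then have "x \<in> {0<..\<delta>}" and "ennreal \<beta> \<le> ennreal (k x)"
          using elim \<eta>(2) by (auto intro: ennreal_leI)
        with True show ?thesis
          by (simp only: indicator_simps mult_1_right) (rule mult_right_mono, auto)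
      qed simp
    qed
  qed
  also have "\<dots> = (\<integral>\<^sup>+x. ennreal \<bar>x\<bar> * indicator {0<..\<delta>} \<bar>x\<bar> * F \<bar>x\<bar> \<partial>\<nu>)"
    by (rule nn_integral_symmetrized_density[OF s z k, symmetric]) measurable
  also have "\<dots> \<le> (\<integral>\<^sup>+x. ennreal (1 - cos (u * x)) \<partial>\<nu>)"
    by (intro nn_integral_mono)
      (auto simp: F_def cos indicator_def ennreal_mult'[symmetric])
  also have "\<dots> = ennreal (\<integral>x. 1 - cos (u * x) \<partial>\<nu>)"
    by (intro nn_integral_eq_integral norm_char_le_exp_integral(1)[OF T]) auto
  finally have "\<beta> * (ln (v * \<eta>) - 1) \<le> (\<integral>x. 1 - cos (u * x) \<partial>\<nu>)"
    by (subst (asm) ennreal_le_iff) (auto intro!: integral_nonneg_AE)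
  then have "cmod (char \<mu> u) \<le> exp (- (\<beta> * (ln (v * \<eta>) - 1)))"
    using norm_char_le_exp_integral(2)[OF T, of u] by (meson exp_le_cancel_iff neg_le_iff_le order_trans)
  also have "\<dots> = exp \<beta> * (v * \<eta>) powr (- \<beta>)"
    using v \<eta> by (simp add: powr_def exp_add[symmetric] algebra_simps)
  finally show ?thesis by (simp add: v_def)
qed

lemma integrable_tail_powr:
  fixes p a :: real
  assumes p: "p > 1" and a: "a > 0"
  shows "integrable lborel (\<lambda>u. indicator {a..} \<bar>u\<bar> * \<bar>u\<bar> powr (- p))"
proof -
  let ?f = "\<lambda>u. indicator {a..} u * u powr (- p)"
  have "((\<lambda>x. - (x powr (1 - p)) / (p - 1)) \<longlongrightarrow> - 0 / (p - 1)) at_top"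
    using p by (intro tendsto_intros tendsto_neg_powr filterlim_ident) auto
  moreover have "((\<lambda>x. - (x powr (1 - p)) / (p - 1)) has_real_derivative x powr (- p)) (at x)" if "0 < x" for x
  proof -
    have "- ((1 - p) * x powr (1 - p - 1)) / (p - 1) = x powr (- p)"
      using p by (simp add: divide_simps) (simp add: algebra_simps)
    with DERIV_cdivide[OF DERIV_minus[OF has_real_derivative_powr[OF that]], of "1 - p" "p - 1"]
    show ?thesis by simp
  qed
  ultimately have "(\<integral>\<^sup>+u. ennreal (u powr (- p)) * indicator {a..} u \<partial>lborel) = ennreal (- 0 / (p - 1) - - (a powr (1 - p)) / (p - 1))"
    using p a
    by (intro nn_integral_FTC_atLeast) auto
  also have "(\<integral>\<^sup>+u. ennreal (u powr (- p)) * indicator {a..} u \<partial>lborel) = (\<integral>\<^sup>+u. ennreal (?f u) \<partial>lborel)"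
    by (intro nn_integral_cong) (auto simp: indicator_def)
  finally have f: "integrable lborel ?f"
    by (intro integrableI_nonneg) auto
  then have "integrable lborel (\<lambda>u. ?f (0 + (- 1) * u))"
    by (intro lborel_integrable_real_affine) auto
  with f have "integrable lborel (\<lambda>u. ?f u + ?f (0 + (- 1) * u))"
    by (rule Bochner_Integration.integrable_add)
  moreover have "(\<lambda>u. ?f u + ?f (0 + (- 1) * u)) = (\<lambda>u. indicator {a..} \<bar>u\<bar> * \<bar>u\<bar> powr (- p))"
    using a by (auto simp: indicator_def abs_if)
  ultimately show ?thesis by simp
qed

lemma integrable_moment_of_polynomial_decay:
  fixes \<phi> :: "real \<Rightarrow> complex"
  assumes [measurable]: "\<phi> \<in> borel_measurable borel" and bounded: "\<And>u. cmod (\<phi> u) \<le> 1"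
    and decay: "\<And>u. a \<le> \<bar>u\<bar> \<Longrightarrow> cmod (\<phi> u) \<le> C * \<bar>u\<bar> powr (- \<beta>)"
    and a: "0 < a" and C: "0 \<le> C" and j: "real j + 1 < \<beta>"
  shows "integrable lborel (\<lambda>t. \<bar>t\<bar> ^ j * cmod (\<phi> t))"
proof (rule Bochner_Integration.integrable_bound)
  let ?p = "\<beta> - real j"
  show "integrable lborel (\<lambda>t. a ^ j * indicator {-a..a} t + C * (indicator {a..} \<bar>t\<bar> * \<bar>t\<bar> powr (- ?p)))"
    using a j by (intro Bochner_Integration.integrable_add integrable_mult_right integrable_tail_powr) auto
  show "AE t in lborel. norm (\<bar>t\<bar> ^ j * cmod (\<phi> t))
      \<le> norm (a ^ j * indicator {-a..a} t + C * (indicator {a..} \<bar>t\<bar> * \<bar>t\<bar> powr (- ?p)))"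
  proof (rule AE_I2)
    fix t :: real
    have nonneg: "0 \<le> C * (indicator {a..} \<bar>t\<bar> * \<bar>t\<bar> powr (- ?p))" using C by simp
    show "norm (\<bar>t\<bar> ^ j * cmod (\<phi> t))
      \<le> norm (a ^ j * indicator {-a..a} t + C * (indicator {a..} \<bar>t\<bar> * \<bar>t\<bar> powr (- ?p)))"
    proof (cases "\<bar>t\<bar> \<le> a")
      case True
      have "\<bar>t\<bar> ^ j * cmod (\<phi> t) \<le> a ^ j * 1"
        using True bounded a by (intro mult_mono power_mono) auto
      moreover have "t \<in> {-a..a}" using True by auto
      ultimately show ?thesis using nonneg a by simp
    next
      case False
      then have "\<bar>t\<bar> ^ j * cmod (\<phi> t) \<le> \<bar>t\<bar> ^ j * (C * \<bar>t\<bar> powr (- \<beta>))"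
        by (intro mult_left_mono decay) auto
      also have "\<dots> = C * \<bar>t\<bar> powr (- ?p)"
        using False a by (simp add: powr_diff powr_minus powr_realpow divide_simps)
      also have "\<dots> = a ^ j * indicator {-a..a} t + C * (indicator {a..} \<bar>t\<bar> * \<bar>t\<bar> powr (- ?p))"
        using False by (auto simp: indicator_def)
      finally show ?thesis by simp
    qed
  qed
qed measurable

lemma AE_lower_bound_near_0:
  fixes k g :: "real \<Rightarrow> real"
  assumes eq: "AE x in lborel. x \<in> {0<..<\<delta>} \<longrightarrow> g x = k x" and "0 < \<delta>"
    and lim: "(g \<longlongrightarrow> \<alpha>) (at_right 0)" and "\<beta> < \<alpha>"
  obtains \<eta> where "0 < \<eta>" "\<eta> \<le> \<delta>" "AE x in lborel. x \<in> {0<..\<eta>} \<longrightarrow> \<beta> \<le> k x"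
proof -
  have "\<forall>\<^sub>F x in at_right 0. \<beta> < g x"
    using lim \<open>\<beta> < \<alpha>\<close> by (rule order_tendstoD)
  then obtain c where c: "0 < c" "\<And>x. 0 < x \<Longrightarrow> x < c \<Longrightarrow> \<beta> < g x"
    unfolding eventually_at_right_field by blast
  show ?thesis
  proof (rule that[of "min c \<delta> / 2"])
    show "AE x in lborel. x \<in> {0<..min c \<delta> / 2} \<longrightarrow> \<beta> \<le> k x"
      using eq
    proof eventually_elim
      case (elim x)
      show ?case
      proof
        assume "x \<in> {0<..min c \<delta> / 2}"
        then have "0 < x" "x < c" "x < \<delta>" using c(1) \<open>0 < \<delta>\<close> by auto
        then show "\<beta> \<le> k x" using elim c(2)[of x] by auto
      qed
    qed
  qed (use c(1) \<open>0 < \<delta>\<close> in auto)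
qed

section \<open>Fourier inversion and smoothness of the density\<close>

text \<open>
  Differentiation under the integral sign: by the mean value inequality \<open>w\<close> is a Lipschitz constant
  of \<open>k\<close> in its first argument, so \<open>2 w\<close> dominates the remainders of the difference quotients.
\<close>

lemma has_vector_derivative_integral:
  fixes k k' :: "real \<Rightarrow> 'a \<Rightarrow> 'b::{banach, second_countable_topology}"
  assumes int: "\<And>x. integrable M (k x)"
    and meas: "\<And>x. k' x \<in> borel_measurable M"
    and deriv: "\<And>x t. ((\<lambda>x. k x t) has_vector_derivative k' x t) (at x)"
    and bound: "\<And>x t. norm (k' x t) \<le> w t"
    and w: "integrable M w"
  shows "((\<lambda>x. \<integral>t. k x t \<partial>M) has_vector_derivative (\<integral>t. k' x t \<partial>M)) (at x)"
proof -
  have k'_int: "integrable M (k' x)" for x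
    by (rule Bochner_Integration.integrable_bound[OF w meas])
      (intro AE_I2 order_trans[OF bound], simp)
  have lipschitz: "norm (k y t - k x t) \<le> w t * norm (y - x)" for x y t
  proof (rule differentiable_bound[of UNIV])
    show "((\<lambda>x. k x t) has_derivative (\<lambda>h. h *\<^sub>R k' z t)) (at z within UNIV)" for z
      using deriv by (simp add: has_vector_derivative_def)
    show "onorm (\<lambda>h. h *\<^sub>R k' z t) \<le> w t" for z
      using bound[of z t] by (intro onorm_le) (simp add: mult.commute mult_left_mono)
  qed auto
  have "((\<lambda>y. ((\<integral>t. k y t \<partial>M) - (\<integral>t. k x t \<partial>M) - (y - x) *\<^sub>R (\<integral>t. k' x t \<partial>M)) /\<^sub>R norm (y - x)) \<longlongrightarrow> 0) (at x)"
    unfolding tendsto_at_iff_sequentially comp_def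
  proof (intro allI impI)
    fix X :: "nat \<Rightarrow> real"
    assume X: "\<forall>i. X i \<in> UNIV - {x}" "X \<longlonglongrightarrow> x"
    have "(\<lambda>i. \<integral>t. (k (X i) t - k x t - (X i - x) *\<^sub>R k' x t) /\<^sub>R norm (X i - x) \<partial>M) \<longlonglongrightarrow> (\<integral>t. 0 \<partial>M)"
    proof (rule integral_dominated_convergence[where w="\<lambda>t. 2 * w t"])
      note [measurable] = borel_measurable_integrable[OF int] meas
      show "(\<lambda>t. (k (X i) t - k x t - (X i - x) *\<^sub>R k' x t) /\<^sub>R norm (X i - x)) \<in> borel_measurable M" for i
        by measurable
      show "integrable M (\<lambda>t. 2 * w t)" using w by simp
      show "AE t in M. (\<lambda>i. (k (X i) t - k x t - (X i - x) *\<^sub>R k' x t) /\<^sub>R norm (X i - x)) \<longlonglongrightarrow> 0"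
      proof (rule AE_I2)
        fix t
        have "((\<lambda>y. (k y t - k x t - (y - x) *\<^sub>R k' x t) /\<^sub>R norm (y - x)) \<longlongrightarrow> 0) (at x)"
          using deriv[of t x] by (simp add: has_vector_derivative_def has_derivative_at_within)
        then show "(\<lambda>i. (k (X i) t - k x t - (X i - x) *\<^sub>R k' x t) /\<^sub>R norm (X i - x)) \<longlonglongrightarrow> 0"
          using X unfolding tendsto_at_iff_sequentially comp_def by blast
      qed
      show "AE t in M. norm ((k (X i) t - k x t - (X i - x) *\<^sub>R k' x t) /\<^sub>R norm (X i - x)) \<le> 2 * w t" for i
      proof (rule AE_I2)
        fix t
        have "norm (k (X i) t - k x t - (X i - x) *\<^sub>R k' x t)
            \<le> norm (k (X i) t - k x t) + norm ((X i - x) *\<^sub>R k' x t)"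
          by (rule norm_triangle_ineq4)
        also have "\<dots> \<le> w t * norm (X i - x) + norm (X i - x) * w t"
          using bound[of x t] by (intro add_mono lipschitz) (auto intro: mult_left_mono)
        finally have "norm (k (X i) t - k x t - (X i - x) *\<^sub>R k' x t) \<le> 2 * w t * norm (X i - x)"
          by simp
        moreover have "X i \<noteq> x" using X(1) by auto
        ultimately show "norm ((k (X i) t - k x t - (X i - x) *\<^sub>R k' x t) /\<^sub>R norm (X i - x)) \<le> 2 * w t"
          by (simp add: divide_simps mult.commute)
      qed
    qed simp
    moreover have "(\<integral>t. (k (X i) t - k x t - (X i - x) *\<^sub>R k' x t) /\<^sub>R norm (X i - x) \<partial>M)
        = ((\<integral>t. k (X i) t \<partial>M) - (\<integral>t. k x t \<partial>M) - (X i - x) *\<^sub>R (\<integral>t. k' x t \<partial>M)) /\<^sub>R norm (X i - x)" for i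
      using int k'_int by simp
    ultimately show "(\<lambda>i. ((\<integral>t. k (X i) t \<partial>M) - (\<integral>t. k x t \<partial>M) - (X i - x) *\<^sub>R (\<integral>t. k' x t \<partial>M)) /\<^sub>R norm (X i - x)) \<longlonglongrightarrow> 0"
      by (simp only: Bochner_Integration.integral_zero)
  qed
  then show ?thesis
    by (simp add: has_vector_derivative_def has_derivative_at_within bounded_linear_scaleR_left)
qed

text \<open>
  For integrable \<open>\<phi>\<close> and \<open>j = 0\<close> this is the inverse Fourier transform of \<open>\<phi>\<close>; differentiating the
  integrand in \<open>x\<close> raises \<open>j\<close> by one.
\<close>
definition fourier_moment :: "(real \<Rightarrow> complex) \<Rightarrow> nat \<Rightarrow> real \<Rightarrow> complex" where
  "fourier_moment \<phi> j x =
     (CLBINT t. (- \<i> * complex_of_real t) ^ j * iexp (- (t * x)) * \<phi> t) / (2 * pi)"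

lemma norm_fourier_integrand:
  "cmod ((- \<i> * complex_of_real t) ^ j * iexp (- (t * x)) * z) = \<bar>t\<bar> ^ j * cmod z"
  by (simp add: norm_mult norm_power)

lemma fourier_integrand_integrable:
  fixes \<phi> :: "real \<Rightarrow> complex"
  assumes [measurable]: "\<phi> \<in> borel_measurable borel"
    and int: "integrable lborel (\<lambda>t. \<bar>t\<bar> ^ j * cmod (\<phi> t))"
  shows "complex_integrable lborel (\<lambda>t. (- \<i> * complex_of_real t) ^ j * iexp (- (t * x)) * \<phi> t)"
proof (rule Bochner_Integration.integrable_bound[OF int])
  show "AE t in lborel. norm ((- \<i> * complex_of_real t) ^ j * iexp (- (t * x)) * \<phi> t)
      \<le> norm (\<bar>t\<bar> ^ j * cmod (\<phi> t))"
    unfolding norm_fourier_integrand by simp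
qed measurable

lemma isCont_fourier_moment:
  fixes \<phi> :: "real \<Rightarrow> complex"
  assumes [measurable]: "\<phi> \<in> borel_measurable borel"
    and int: "integrable lborel (\<lambda>t. \<bar>t\<bar> ^ j * cmod (\<phi> t))"
  shows "isCont (fourier_moment \<phi> j) x"
proof -
  have "(fourier_moment \<phi> j \<longlongrightarrow> fourier_moment \<phi> j x) (at x)"
    unfolding tendsto_at_iff_sequentially comp_def fourier_moment_def
  proof (intro allI impI tendsto_intros)
    fix X :: "nat \<Rightarrow> real"
    assume X: "X \<longlonglongrightarrow> x"
    show "(\<lambda>i. CLBINT t. (- \<i> * complex_of_real t) ^ j * iexp (- (t * X i)) * \<phi> t)
        \<longlonglongrightarrow> (CLBINT t. (- \<i> * complex_of_real t) ^ j * iexp (- (t * x)) * \<phi> t)"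
    proof (rule integral_dominated_convergence[OF _ _ int])
      show "AE t in lborel. (\<lambda>i. (- \<i> * complex_of_real t) ^ j * iexp (- (t * X i)) * \<phi> t)
          \<longlonglongrightarrow> (- \<i> * complex_of_real t) ^ j * iexp (- (t * x)) * \<phi> t"
        using X by (intro AE_I2 tendsto_intros)
      show "AE t in lborel. norm ((- \<i> * complex_of_real t) ^ j * iexp (- (t * X i)) * \<phi> t)
          \<le> \<bar>t\<bar> ^ j * cmod (\<phi> t)" for i
        unfolding norm_fourier_integrand by simp
    qed measurable
  qed simp
  then show ?thesis by (simp add: isCont_def)
qed

lemma has_vector_derivative_fourier_moment:
  fixes \<phi> :: "real \<Rightarrow> complex"
  assumes [measurable]: "\<phi> \<in> borel_measurable borel"
    and int: "integrable lborel (\<lambda>t. \<bar>t\<bar> ^ j * cmod (\<phi> t))"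
    and int': "integrable lborel (\<lambda>t. \<bar>t\<bar> ^ Suc j * cmod (\<phi> t))"
  shows "(fourier_moment \<phi> j has_vector_derivative fourier_moment \<phi> (Suc j) x) (at x)"
proof -
  have "((\<lambda>x. CLBINT t. (- \<i> * complex_of_real t) ^ j * iexp (- (t * x)) * \<phi> t) has_vector_derivative
      (CLBINT t. (- \<i> * complex_of_real t) ^ Suc j * iexp (- (t * x)) * \<phi> t)) (at x)"
  proof (rule has_vector_derivative_integral[OF _ _ _ _ int'])
    show "complex_integrable lborel (\<lambda>t. (- \<i> * complex_of_real t) ^ j * iexp (- (t * x)) * \<phi> t)" for x
      by (rule fourier_integrand_integrable) (use int in auto)
    show "((\<lambda>x. (- \<i> * complex_of_real t) ^ j * iexp (- (t * x)) * \<phi> t) has_vector_derivative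
        (- \<i> * complex_of_real t) ^ Suc j * iexp (- (t * x)) * \<phi> t) (at x)" for x t
    proof -
      have "((\<lambda>z. (- \<i> * complex_of_real t) ^ j * exp (\<i> * (- (complex_of_real t * z))) * \<phi> t) has_field_derivative
          (- \<i> * complex_of_real t) ^ Suc j * iexp (- (t * x)) * \<phi> t) (at (complex_of_real x))"
        by (auto intro!: derivative_eq_intros)
      from has_vector_derivative_real_field[OF this] show ?thesis by simp
    qed
    show "norm ((- \<i> * complex_of_real t) ^ Suc j * iexp (- (t * x)) * \<phi> t) \<le> \<bar>t\<bar> ^ Suc j * cmod (\<phi> t)" for x t
      unfolding norm_fourier_integrand by simp
  qed measurable
  then have "((\<lambda>x. (CLBINT t. (- \<i> * complex_of_real t) ^ j * iexp (- (t * x)) * \<phi> t) / (2 * pi))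
      has_vector_derivative fourier_moment \<phi> (Suc j) x) (at x)"
    unfolding fourier_moment_def by (rule has_vector_derivative_divide)
  then show ?thesis
    by (simp add: fourier_moment_def[abs_def])
qed

lemma C_n_Re_fourier_moment:
  fixes \<phi> :: "real \<Rightarrow> complex"
  assumes [measurable]: "\<phi> \<in> borel_measurable borel"
    and int: "\<And>j. j \<le> n \<Longrightarrow> integrable lborel (\<lambda>t. \<bar>t\<bar> ^ j * cmod (\<phi> t))"
  shows "C_n n (\<lambda>x. Re (fourier_moment \<phi> 0 x))"
proof -
  have D: "((\<lambda>x. Re (fourier_moment \<phi> j x)) has_real_derivative Re (fourier_moment \<phi> (Suc j) x)) (at x)"
    if "j < n" for j x
    unfolding has_real_derivative_iff_has_vector_derivative
    using that
    by (intro bounded_linear.has_vector_derivative[OF bounded_linear_Re]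
        has_vector_derivative_fourier_moment int assms(1)) auto
  have eq: "(deriv ^^ j) (\<lambda>x. Re (fourier_moment \<phi> 0 x)) = (\<lambda>x. Re (fourier_moment \<phi> j x))"
    if "j \<le> n" for j
    using that
  proof (induction j)
    case (Suc j)
    then show ?case using D[of j] by (auto intro!: ext DERIV_imp_deriv)
  qed simp
  show ?thesis
    unfolding C_n_def
  proof (intro conjI allI impI)
    show "(deriv ^^ j) (\<lambda>x. Re (fourier_moment \<phi> 0 x)) field_differentiable at x" if "j < n" for j x
      using that D[of j x] by (auto simp: eq field_differentiable_def)
    show "continuous_on UNIV ((deriv ^^ j) (\<lambda>x. Re (fourier_moment \<phi> 0 x)))" if "j \<le> n" for j
      unfolding eq[OF that]
      by (intro continuous_at_imp_continuous_on ballI continuous_intros isCont_fourier_moment int that assms(1))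
  qed
qed

text \<open>
  Levy's inversion formula expresses increments of the distribution function between points that are
  not atoms as increments of a function \<open>R\<close>, the integral of \<open>(1 - e\<^sup>-\<^sup>i\<^sup>t\<^sup>x) / (i t) \<phi>(t)\<close> up to a
  factor; the limit in that formula is an ordinary integral because \<open>\<phi>\<close> is integrable. Hence
  \<open>cdf - R\<close> is constant off the countably many atoms, and everywhere by right continuity. The
  derivative of \<open>R\<close> is the inverse Fourier transform.
\<close>
lemma (in real_distribution) cdf_has_derivative_fourier_moment:
  assumes int: "integrable lborel (char M)"
  shows "(cdf M has_real_derivative Re (fourier_moment (char M) 0 x)) (at x)"
proof -
  let ?\<phi> = "char M"
  define k where "k x t = (1 - iexp (- (t * x))) / (\<i> * complex_of_real t) * ?\<phi> t" for x t
  \<comment> \<open>At \<open>t = 0\<close> the quotient defining \<open>k\<close> is a division by zero, so \<open>k\<close> vanishes there for all \<open>x\<close>.\<close>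
  define k' where "k' x t = (if t = 0 then 0 else iexp (- (t * x)) * ?\<phi> t)" for x t
  have [measurable]: "k x \<in> borel_measurable borel" "k' x \<in> borel_measurable borel" for x
    unfolding k_def k'_def by measurable
  have k_bound: "cmod (k x t) \<le> \<bar>x\<bar> * cmod (?\<phi> t)" for x t
  proof (cases "t = 0")
    case False
    have "cmod (1 - iexp (- (t * x))) \<le> \<bar>t * x\<bar>"
      using iexp_approx1[of "- (t * x)" 0] by (simp add: norm_minus_commute abs_mult)
    then have "cmod (1 - iexp (- (t * x))) / \<bar>t\<bar> \<le> \<bar>x\<bar>"
      using False by (simp add: abs_mult divide_simps mult.commute)
    then show ?thesis
      unfolding k_def by (simp only: norm_mult norm_divide) (intro mult_right_mono; simp)
  qed (simp add: k_def)
  have k_int: "integrable lborel (k x)" for x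
  proof (rule Bochner_Integration.integrable_bound)
    show "integrable lborel (\<lambda>t. \<bar>x\<bar> * cmod (?\<phi> t))" using int by simp
  qed (use k_bound in \<open>auto simp: abs_mult\<close>)
  have k_deriv: "((\<lambda>x. k x t) has_vector_derivative k' x t) (at x)" for x t
  proof (cases "t = 0")
    case False
    have "((\<lambda>z. (1 - exp (\<i> * (- (complex_of_real t * z)))) / (\<i> * complex_of_real t) * ?\<phi> t)
        has_field_derivative k' x t) (at (complex_of_real x))"
      using False
      by (auto intro!: derivative_eq_intros simp: k'_def mult.left_commute[of "exp _" "\<i>"])
    from has_vector_derivative_real_field[OF this] show ?thesis by (simp add: k_def)
  qed (simp add: k_def k'_def)
  have k'_bound: "norm (k' x t) \<le> cmod (?\<phi> t)" for x t
    by (simp add: k'_def norm_mult)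
  define G where "G x = (CLBINT t. k x t) / (2 * pi)" for x
  have "((\<lambda>x. CLBINT t. k x t) has_vector_derivative (CLBINT t. k' x t)) (at x)" for x
    by (rule has_vector_derivative_integral[OF k_int _ k_deriv k'_bound])
      (use int in auto)
  moreover have "(CLBINT t. k' x t) = (CLBINT t. iexp (- (t * x)) * ?\<phi> t)" for x
  proof (rule integral_cong_AE)
    show "AE t in lborel. k' x t = iexp (- (t * x)) * ?\<phi> t"
      using AE_lborel_singleton[of 0] by eventually_elim (simp add: k'_def)
  qed measurable
  ultimately have "((\<lambda>x. (CLBINT t. k x t) / (2 * pi)) has_vector_derivative
      (CLBINT t. iexp (- (t * x)) * ?\<phi> t) / (2 * pi)) (at x)" for x
    by (metis has_vector_derivative_divide)
  then have G_deriv: "(G has_vector_derivative fourier_moment ?\<phi> 0 x) (at x)" for x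
    by (simp add: G_def[abs_def] fourier_moment_def)
  define R where "R x = Re (G x)" for x
  have R_deriv: "(R has_real_derivative Re (fourier_moment ?\<phi> 0 x)) (at x)" for x
    unfolding has_real_derivative_iff_has_vector_derivative R_def
    by (rule bounded_linear.has_vector_derivative[OF bounded_linear_Re G_deriv])
  have increment: "cdf M b - cdf M a = R b - R a"
    if "a < b" "measure M {a} = 0" "measure M {b} = 0" for a b
  proof -
    let ?F = "\<lambda>t. (iexp (- (t * a)) - iexp (- (t * b))) / (\<i> * complex_of_real t) * ?\<phi> t"
    have F: "?F = (\<lambda>t. k b t - k a t)"
      by (auto simp: k_def field_simps diff_divide_distrib)
    have F_int: "complex_integrable lborel ?F"
      unfolding F by (intro Bochner_Integration.integrable_diff k_int)
    have "(\<lambda>T::nat. CLBINT t. indicator {- real T<..<real T} t *\<^sub>R ?F t) \<longlonglongrightarrow> (CLBINT t. ?F t)"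
    proof (rule integral_dominated_convergence[where w="\<lambda>t. cmod (?F t)"])
      show "AE t in lborel. (\<lambda>T. indicator {- real T<..<real T} t *\<^sub>R ?F t) \<longlonglongrightarrow> ?F t"
      proof (rule AE_I2)
        fix t
        have "\<forall>\<^sub>F T in sequentially. \<bar>t\<bar> < real T"
          using filterlim_real_sequentially filterlim_at_top_dense by blast
        then have "\<forall>\<^sub>F T in sequentially. indicator {- real T<..<real T} t *\<^sub>R ?F t = ?F t"
          by eventually_elim (auto simp: indicator_def)
        then show "(\<lambda>T. indicator {- real T<..<real T} t *\<^sub>R ?F t) \<longlonglongrightarrow> ?F t"
          by (rule tendsto_eventually)
      qed
      show "AE t in lborel. norm (indicator {- real T<..<real T} t *\<^sub>R ?F t) \<le> cmod (?F t)" for T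
        by (auto simp: indicator_def)
    qed (use F_int in auto)
    moreover have "(CLBINT t=-T..T. ?F t) = (CLBINT t. indicator {- real T<..<real T} t *\<^sub>R ?F t)" for T :: nat
      by (simp add: interval_lebesgue_integral_def set_lebesgue_integral_def)
    ultimately have "(\<lambda>T::nat. 1 / (2 * pi) * (CLBINT t=-T..T. ?F t)) \<longlonglongrightarrow> 1 / (2 * pi) * (CLBINT t. ?F t)"
      by (intro tendsto_intros) simp
    moreover have "(\<lambda>T::nat. 1 / (2 * pi) * (CLBINT t=-T..T. ?F t)) \<longlonglongrightarrow> of_real (measure M {a<..b})"
      using Levy_Inversion[of a b] that by simp
    ultimately have "of_real (measure M {a<..b}) = 1 / (2 * pi) * (CLBINT t. ?F t)"
      using LIMSEQ_unique by blast
    also have "\<dots> = G b - G a"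
      unfolding F G_def using k_int by (simp add: diff_divide_distrib)
    finally have "measure M {a<..b} = R b - R a"
      unfolding R_def by (metis Re_complex_of_real minus_complex.sel(1))
    then show ?thesis
      using finite_borel_measure.cdf_diff_eq[OF finite_borel_measure_M \<open>a < b\<close>] by simp
  qed
  define A where "A = {x. measure M {x} \<noteq> 0}"
  have A: "countable A" unfolding A_def by (rule countable_support)
  obtain z where z: "z \<notin> A"
    using real_interval_avoid_countable_set[of 0 1, OF _ A] by auto
  define D where "D x = cdf M x - R x" for x
  have D_off: "D y = D z" if "y \<notin> A" for y
    using increment[of y z] increment[of z y] that z
    by (cases y z rule: linorder_cases) (auto simp: A_def D_def)
  have "D y = D z" for y
  proof (rule ccontr)
    assume ne: "D y \<noteq> D z"
    have "(cdf M \<longlongrightarrow> cdf M y) (at_right y)"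
      using finite_borel_measure.cdf_is_right_cont[OF finite_borel_measure_M]
      by (simp add: continuous_within)
    moreover have "(R \<longlongrightarrow> R y) (at_right y)"
      using DERIV_isCont[OF R_deriv] continuous_at_imp_continuous_at_within continuous_within by blast
    ultimately have "(D \<longlongrightarrow> D y) (at_right y)"
      unfolding D_def[abs_def] by (intro tendsto_diff)
    then have "\<forall>\<^sub>F x in at_right y. D x \<noteq> D z"
      using ne by (rule tendsto_imp_eventually_ne)
    then obtain c where "y < c" "\<And>x. y < x \<Longrightarrow> x < c \<Longrightarrow> D x \<noteq> D z"
      unfolding eventually_at_right_field by blast
    then show False
      using real_interval_avoid_countable_set[OF _ A, of y c] D_off by fastforce
  qed
  then have "cdf M = (\<lambda>x. R x + D z)"
    by (auto simp: D_def algebra_simps)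
  moreover have "((\<lambda>x. R x + D z) has_real_derivative Re (fourier_moment ?\<phi> 0 x)) (at x)"
    by (auto intro!: derivative_eq_intros R_deriv)
  ultimately show ?thesis by simp
qed

theorem (in real_distribution) density_fourier_inversion:
  assumes int: "integrable lborel (char M)"
  defines "f \<equiv> \<lambda>x. Re (fourier_moment (char M) 0 x)"
  shows "0 \<le> f x" and "M = density lborel (\<lambda>x. ennreal (f x))"
proof -
  have D: "(cdf M has_real_derivative f x) (at x)" for x
    unfolding f_def by (rule cdf_has_derivative_fourier_moment[OF int])
  show nonneg: "0 \<le> f x" for x
    using finite_borel_measure.cdf_nondecreasing[OF finite_borel_measure_M]
    by (intro mono_on_imp_deriv_nonneg[OF _ D, of UNIV]) (auto simp: mono_on_def)
  have "isCont f x" for x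
    using isCont_fourier_moment[of "char M" 0 x] int unfolding f_def isCont_def
    by (intro tendsto_Re) simp
  then have [measurable]: "f \<in> borel_measurable borel"
    by (intro borel_measurable_continuous_onI continuous_at_imp_continuous_on) auto
  show "M = density lborel (\<lambda>x. ennreal (f x))"
  proof (rule measure_eqI_lessThan)
    fix x
    show "emeasure M {x<..} < \<infinity>" by (simp add: less_top[symmetric])
    have "emeasure (density lborel (\<lambda>x. ennreal (f x))) {x<..}
        = (\<integral>\<^sup>+y. ennreal (f y) * indicator {x..} y \<partial>lborel)"
    proof (subst emeasure_density)
      show "(\<integral>\<^sup>+y. ennreal (f y) * indicator {x<..} y \<partial>lborel)
          = (\<integral>\<^sup>+y. ennreal (f y) * indicator {x..} y \<partial>lborel)"
      proof (rule nn_integral_cong_AE)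
        show "AE y in lborel. ennreal (f y) * indicator {x<..} y = ennreal (f y) * indicator {x..} y"
          using AE_lborel_singleton[of x] by eventually_elim (auto simp: indicator_def)
      qed
    qed auto
    also have "\<dots> = ennreal (1 - cdf M x)"
      using D nonneg cdf_lim_at_top_prob by (intro nn_integral_FTC_atLeast) auto
    also have "1 - cdf M x = measure M {x<..}"
      using prob_compl[of "{..x}"] by (simp add: cdf_def Compl_eq_Diff_UNIV[symmetric])
    finally show "emeasure M {x<..} = emeasure (density lborel (\<lambda>x. ennreal (f x))) {x<..}"
      by (simp add: emeasure_eq_measure)
  qed auto
qed

section \<open>Smooth densities of infinitely divisible distributions\<close>

theorem corollary4:
  fixes \<mu> \<nu> :: "real measure" and \<sigma>2 \<gamma> \<delta> \<alpha> :: real and k\<^sub>s :: "real \<Rightarrow> real"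
  assumes "infinitely_divisible \<mu>"
    and "characteristic_triplet \<mu> \<sigma>2 \<gamma> \<nu>"
    and "0 < \<delta>" and "\<delta> < 1"
    and "admits_density_on (density (symmetrized_jump_measure \<nu>) (\<lambda>x. ennreal x)) {0<..\<delta>} k\<^sub>s"
    and "\<And>\<epsilon>. 0 < \<epsilon> \<Longrightarrow> \<epsilon> < \<delta> \<Longrightarrow> BV \<epsilon> \<delta> k\<^sub>s"
    and "positive_TV_from_0 \<delta> k\<^sub>s < \<infinity>"
    and "BV 0 \<delta> k\<^sub>s"
    and "absolutely_continuous lborel (density \<nu> (\<lambda>x. ennreal \<bar>x\<bar>))"
    and "\<alpha> = right_limit 0 \<delta> k\<^sub>s 0"
    and "\<alpha> > 1"
  shows "\<exists>f. (\<forall>x. 0 \<le> f x) \<and> \<mu> = density lborel (\<lambda>x. ennreal (f x)) \<and>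
           (\<forall>n::nat. real n < \<alpha> - 1 \<longrightarrow> C_n n f)"
proof -
  interpret real_distribution \<mu>
    using \<open>infinitely_divisible \<mu>\<close> by (simp add: infinitely_divisible_def)
  obtain g where g: "AE y in lborel. y \<in> {0<..<\<delta>} \<longrightarrow> g y = k\<^sub>s y"
    and lim: "(g \<longlongrightarrow> \<alpha>) (at_right 0)"
    using right_limit_BV[OF \<open>BV 0 \<delta> k\<^sub>s\<close> \<open>0 < \<delta>\<close>] \<open>\<alpha> = right_limit 0 \<delta> k\<^sub>s 0\<close> by blast
  have moment: "integrable lborel (\<lambda>t. \<bar>t\<bar> ^ j * cmod (char \<mu> t))" if "real j < \<alpha> - 1" for j
  proof -
    \<comment> \<open>Any exponent strictly between \<open>j + 1\<close> and \<open>\<alpha>\<close> will do.\<close>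
    define \<beta> where "\<beta> = (real j + 1 + \<alpha>) / 2"
    have \<beta>: "real j + 1 < \<beta>" "\<beta> < \<alpha>" "0 \<le> \<beta>"
      using that by (auto simp: \<beta>_def)
    obtain \<eta> where \<eta>: "0 < \<eta>" "\<eta> \<le> \<delta>" "AE x in lborel. x \<in> {0<..\<eta>} \<longrightarrow> \<beta> \<le> k\<^sub>s x"
      using AE_lower_bound_near_0[OF g \<open>0 < \<delta>\<close> lim \<beta>(2)] by blast
    show ?thesis
    proof (rule integrable_moment_of_polynomial_decay[OF _ cmod_char_le_1 _ _ _ \<beta>(1)])
      fix u :: real
      assume u: "1 / \<eta> \<le> \<bar>u\<bar>"
      have "cmod (char \<mu> u) \<le> exp \<beta> * (\<bar>u\<bar> * \<eta>) powr (- \<beta>)"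
        by (rule char_polynomial_decay[OF assms(2,5) \<eta>(1,2) \<beta>(3) \<eta>(3) u])
      then show "cmod (char \<mu> u) \<le> (exp \<beta> * \<eta> powr (- \<beta>)) * \<bar>u\<bar> powr (- \<beta>)"
        using \<eta>(1) by (simp add: powr_mult mult_ac)
    qed (use \<eta>(1) in auto)
  qed
  let ?f = "\<lambda>x. Re (fourier_moment (char \<mu>) 0 x)"
  have int: "integrable lborel (char \<mu>)"
    using moment[of 0] \<open>\<alpha> > 1\<close> by (simp add: integrable_norm_iff)
  have "C_n n ?f" if "real n < \<alpha> - 1" for n
    using that by (intro C_n_Re_fourier_moment moment) auto
  then show ?thesis
    using density_fourier_inversion[OF int] by (intro exI[of _ ?f]) auto
qed

end
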